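(* For all $k\ge1$, \[ S_{k,r}=3\cdot2^{2k-r+1}\quad(1\le r\le 2k+1),\qquad S_{k,2k+2}=2,\qquad S_{k,2k+3}=1. \] In particular $\sum_{r}S_{k,r}=6\cdot4^k$.
   Context: Let $\widetilde Q(1)=\widetilde Q(2)=1$ and $\widetilde Q(n)=\widetilde Q(n-\widetilde Q(n-1))+\widetilde Q(n-\widetilde Q(n-2))+(-1)^n$ for $n\ge3$ (well defined, all values odd). Put $A(m):=(\widetilde Q(2m-1)+1)/2$ and $B(m):=(\widetilde Q(2m)+1)/2$ for $m\ge1$. For $v\in\mathbb{N}$ let $F_A(v):=\#\{m\ge1:A(m)=v\}$ and $F_B(v):=\#\{m\ge1:B(m)=v\}$. Let $I_k:=[4^k,4^{k+1}-1]\cap\mathbb{Z}$ and $S_{k,r}:=\#\{v\in I_k:F_A(v)=r\}+\#\{v\in I_k:F_B(v)=r\}$. *)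

theory Defs
  imports Complex_Main
begin

text \<open>
  The sequence is indexed from 1. The range test, which makes the function total, says exactly that
  both inner indices lie in \<open>{1..<n}\<close>, i.e. that the nested recurrence is well defined at \<open>n\<close>;
  the sequence passes it for every \<open>n \<ge> 3\<close>, so the last \<open>0\<close> is never attained
  (nor is the index \<open>0\<close> ever used).
\<close>

function Qt :: "nat \<Rightarrow> int" where
  "Qt n =
     (if n = 0 then 0
      else if n \<le> 2 then 1
      else if 1 \<le> Qt (n - 1) \<and> Qt (n - 1) < int n \<and> 1 \<le> Qt (n - 2) \<and> Qt (n - 2) < int n
      then Qt (n - nat (Qt (n - 1))) + Qt (n - nat (Qt (n - 2))) + (-1) ^ n
      else 0)"
  by auto
termination
  by (relation "measure id") auto

declare Qt.simps [simp del]

lemma Qt_1: "Qt 1 = 1" and Qt_2: "Qt 2 = 1"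
  by (simp_all add: Qt.simps)

lemma Qt_rec:
  assumes "3 \<le> n"
    and "Qt (n - 1) \<in> {1..<int n}" and "Qt (n - 2) \<in> {1..<int n}"
  shows "Qt n = Qt (n - nat (Qt (n - 1))) + Qt (n - nat (Qt (n - 2))) + (-1) ^ n"
  using assms by (subst Qt.simps) auto

text \<open>All values of the sequence are odd, so the divisions by 2 are exact.\<close>

definition A :: "nat \<Rightarrow> int" where
  "A m = (Qt (2 * m - 1) + 1) div 2"

definition B :: "nat \<Rightarrow> int" where
  "B m = (Qt (2 * m) + 1) div 2"

definition F_A :: "nat \<Rightarrow> nat" where
  "F_A v = card {m. 1 \<le> m \<and> A m = int v}"

definition F_B :: "nat \<Rightarrow> nat" where
  "F_B v = card {m. 1 \<le> m \<and> B m = int v}"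

definition I :: "nat \<Rightarrow> nat set" where
  "I k = {4 ^ k..4 ^ (k + 1) - 1}"

definition S :: "nat \<Rightarrow> nat \<Rightarrow> nat" where
  "S k r = card {v \<in> I k. F_A v = r} + card {v \<in> I k. F_B v = r}"

end

theory Submission
  imports Defs
begin

text \<open>
  Encode the sequence by a single two-letter word: the letter at position \<open>v\<close> is \<open>a\<close> if
  \<open>F_A v \<ge> 2\<close> and \<open>b\<close> if \<open>F_B v \<ge> 2\<close>; exactly one of the two happens for every \<open>v\<close>. Writing
  \<open>ca\<close> and \<open>cb\<close> for the letter counts of prefixes, the word is generated by the rule that the
  letter after the \<open>i\<close>-th \<open>a\<close> is opposite to letter \<open>i\<close>, and the letter after the \<open>i\<close>-th \<open>b\<close>
  is opposite to letter \<open>i + 1\<close>. Up to a shift \<open>s\<close> that grows by one at certain long runs, located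
  at Jacobsthal numbers, \<open>A m = ca (m + s)\<close> and \<open>B m = 1 + cb (m + s)\<close>.

  Hence \<open>F_A v = 1 + F_B (ca v)\<close> at the letters \<open>a\<close> and \<open>F_B v = 1 + F_A (cb v)\<close> at the letters \<open>b\<close>
  (except for \<open>v = 2\<close>), and the frequency is \<open>1\<close> otherwise. So the number of values with frequency
  at least \<open>r + 1\<close>, for \<open>F_A\<close> up to \<open>x\<close> and \<open>F_B\<close> up to \<open>y\<close>, is the number of values with frequency
  at least \<open>r\<close>, for \<open>F_A\<close> up to \<open>cb y\<close> and \<open>F_B\<close> up to \<open>ca x\<close>. The word is antisymmetric about
  \<open>2 ^ j\<close> on a window bounded by Jacobsthal numbers, which makes \<open>ca x + cb y\<close> equal to
  \<open>(x + y) / 2\<close> when \<open>x + y\<close> is a power of two. Starting from \<open>x = y = 4 ^ k\<close>, each increase of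
  \<open>r\<close> therefore halves the count.
\<close>

section \<open>The word\<close>

text \<open>\<open>True\<close> stands for the letter \<open>a\<close>. Positions are counted from 1, so \<open>wd 0\<close> is meaningless.\<close>

primrec pref :: "nat \<Rightarrow> bool list" where
  "pref 0 = []"
| "pref (Suc m) = pref m @ [m = 0 \<or> \<not> pref m !
     (if last (pref m) then length (filter id (pref m)) - 1 else length (filter Not (pref m)))]"

definition wd :: "nat \<Rightarrow> bool" where "wd i = last (pref i)"
definition ca :: "nat \<Rightarrow> nat" where "ca m = length (filter id (pref m))"
definition cb :: "nat \<Rightarrow> nat" where "cb m = length (filter Not (pref m))"

lemma length_pref [simp]: "length (pref m) = m"
  by (induction m) auto

lemma ca_0 [simp]: "ca 0 = 0" and cb_0 [simp]: "cb 0 = 0"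
  by (simp_all add: ca_def cb_def)

lemma ca_Suc: "ca (Suc m) = ca m + (if wd (Suc m) then 1 else 0)"
  by (simp add: ca_def wd_def del: disj_not1)

lemma cb_Suc: "cb (Suc m) = cb m + (if wd (Suc m) then 0 else 1)"
  by (simp add: cb_def wd_def del: disj_not1)

lemma ca_add_cb: "ca m + cb m = m"
  by (induction m) (auto simp: ca_Suc cb_Suc)

lemma wd_1: "wd (Suc 0)"
  by (simp add: wd_def)

lemma ca_mono: "m \<le> n \<Longrightarrow> ca m \<le> ca n"
  by (rule lift_Suc_mono_le[of ca]) (auto simp: ca_Suc)

lemma cb_mono: "m \<le> n \<Longrightarrow> cb m \<le> cb n"
  by (rule lift_Suc_mono_le[of cb]) (auto simp: cb_Suc)

lemma ca_pos: "1 \<le> m \<Longrightarrow> 1 \<le> ca m"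
  using ca_mono[of 1 m] by (simp add: ca_Suc wd_1)

lemma ca_le: "ca m \<le> m"
  using ca_add_cb[of m] by simp

lemma cb_less: "1 \<le> m \<Longrightarrow> cb m < m"
  using ca_add_cb[of m] ca_pos[of m] by linarith

lemma nth_pref: "1 \<le> i \<Longrightarrow> i \<le> m \<Longrightarrow> pref m ! (i - 1) = wd i"
proof (induction m)
  case (Suc m)
  show ?case
  proof (cases "i = Suc m")
    case True
    then show ?thesis by (simp add: wd_def last_conv_nth nth_append del: disj_not1)
  next
    case False
    with Suc have "i - 1 < m" "pref m ! (i - 1) = wd i" by auto
    then show ?thesis by (simp add: nth_append del: disj_not1)
  qed
qed simp

lemma wd_Suc: "1 \<le> m \<Longrightarrow> wd (Suc m) = (\<not> wd (if wd m then ca m else Suc (cb m)))"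
  using nth_pref[of "ca m" m] nth_pref[of "Suc (cb m)" m] ca_pos[of m] ca_le[of m] cb_less[of m]
  by (auto simp: wd_def[of "Suc m"] ca_def cb_def wd_def[of m])

lemma wd_Suc_a: "1 \<le> m \<Longrightarrow> wd m \<Longrightarrow> wd (Suc m) = (\<not> wd (ca m))"
  by (simp add: wd_Suc)

lemma wd_Suc_b: "1 \<le> m \<Longrightarrow> \<not> wd m \<Longrightarrow> wd (Suc m) = (\<not> wd (Suc (cb m)))"
  by (simp add: wd_Suc)

section \<open>Initial letters, local rules and recurrences for the counts\<close>

lemma wd_numerals:
  "\<not> wd 2" "wd 3" "wd 4" "\<not> wd 5" "\<not> wd 6"
  "ca 1 = 1" "ca 2 = 1" "ca 3 = 2" "ca 4 = 3" "ca 5 = 3"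
  "cb 1 = 0" "cb 2 = 1" "cb 3 = 1" "cb 4 = 1" "cb 5 = 2"
proof -
  have S: "2 = Suc 1" "3 = Suc 2" "4 = Suc 3" "5 = Suc 4" "6 = Suc 5" by simp_all
  show 11: "ca 1 = 1" "cb 1 = 0" using ca_Suc[of 0] cb_Suc[of 0] wd_1 by simp_all
  show 20: "\<not> wd 2" using wd_Suc_a[of 1] 11 wd_1 unfolding S(1) by simp
  show 21: "ca 2 = 1" "cb 2 = 1" using ca_Suc[of 1] cb_Suc[of 1] 11 20 unfolding S(1) by simp_all
  show 30: "wd 3" using wd_Suc_b[of 2] 20 21 unfolding S(2) by (simp add: numeral_2_eq_2)
  show 31: "ca 3 = 2" "cb 3 = 1" using ca_Suc[of 2] cb_Suc[of 2] 21 30 unfolding S(2) by simp_all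
  show 40: "wd 4" using wd_Suc_a[of 3] 20 30 31 unfolding S(3) by simp
  show 41: "ca 4 = 3" "cb 4 = 1" using ca_Suc[of 3] cb_Suc[of 3] 31 40 unfolding S(3) by simp_all
  show 50: "\<not> wd 5" using wd_Suc_a[of 4] 30 40 41 unfolding S(4) by simp
  show 51: "ca 5 = 3" "cb 5 = 2" using ca_Suc[of 4] cb_Suc[of 4] 41 50 unfolding S(4) by simp_all
  show "\<not> wd 6" using wd_Suc_b[of 5] 30 50 51 unfolding S(5) by simp
qed

text \<open>For a b directly after an a this is the successor rule; along a run of b the count
  \<open>ca\<close> is constant, so the fact is inherited.\<close>

lemma wd_ca_before_b: "1 \<le> v \<Longrightarrow> \<not> wd (Suc v) \<Longrightarrow> wd (ca v)"
proof (induction v rule: dec_induct)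
  case base
  then show ?case by (simp add: ca_Suc wd_1)
next
  case (step v)
  then show ?case using wd_Suc_a[of "Suc v"] by (cases "wd (Suc v)") (auto simp: ca_Suc)
qed

text \<open>The dual inheritance along a run of a. It can start only after the first b, because the
  leading a comes from no rule.\<close>

lemma wd_cb_before_a: "2 \<le> v \<Longrightarrow> wd (Suc v) \<Longrightarrow> \<not> wd (Suc (cb v))"
proof (induction v rule: dec_induct)
  case base
  then show ?case using wd_numerals by (simp add: numeral_eq_Suc)
next
  case (step v)
  then show ?case using wd_Suc_b[of "Suc v"] by (cases "wd (Suc v)") (auto simp: cb_Suc)
qed

text \<open>Read backwards, the rule consults the same position: if letter \<open>v\<close> is b,
  then \<open>ca v = ca (v - 1)\<close> and \<open>wd_ca_before_b\<close> applies. The antisymmetry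
  proof walks left with it.\<close>

lemma wd_pred_a: "2 \<le> v \<Longrightarrow> wd (Suc v) \<Longrightarrow> wd v = (\<not> wd (ca v))"
  using wd_Suc_a[of v] wd_ca_before_b[of "v - 1"] ca_Suc[of "v - 1"]
  by (cases "wd v") auto

lemma wd_pred_b: "3 \<le> v \<Longrightarrow> \<not> wd (Suc v) \<Longrightarrow> wd v = (\<not> wd (Suc (cb v)))"
  using wd_Suc_b[of v] wd_cb_before_a[of "v - 1"] cb_Suc[of "v - 1"]
  by (cases "wd v") auto

text \<open>Among the first \<open>m\<close> letters the a's consult positions 1 to
  \<open>ca m\<close> and the b's positions 2 to \<open>Suc (cb m)\<close>; each b found there
  produces an a, and the 1 is the leading a. This is the nested recurrence of \<open>Qt\<close>
  without shifts.\<close>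

lemma ca_Suc_rec: "1 \<le> m \<Longrightarrow> ca (Suc m) = 1 + cb (ca m) + cb (Suc (cb m))"
proof (induction m rule: dec_induct)
  case base
  then show ?case using wd_numerals wd_1 by (simp add: numeral_eq_Suc ca_Suc cb_Suc)
next
  case (step m)
  show ?case
  proof (cases "wd (Suc m)")
    case True
    then have "ca (Suc m) = Suc (ca m)" "cb (Suc m) = cb m"
      "wd (Suc (Suc m)) = (\<not> wd (Suc (ca m)))"
      using wd_Suc_a[of "Suc m"] by (simp_all add: ca_Suc cb_Suc)
    with step.IH True show ?thesis by (simp add: ca_Suc[of "Suc m"] ca_Suc[of "ca m"] cb_Suc[of "ca m"])
  next
    case False
    then have "ca (Suc m) = ca m" "cb (Suc m) = Suc (cb m)"
      "wd (Suc (Suc m)) = (\<not> wd (Suc (Suc (cb m))))"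
      using wd_Suc_b[of "Suc m"] by (simp_all add: ca_Suc cb_Suc)
    with step.IH False show ?thesis
      by (simp add: ca_Suc[of "Suc m"] ca_Suc[of "Suc (cb m)"] cb_Suc[of "Suc (cb m)"])
  qed
qed

lemma cb_Suc_rec: "1 \<le> m \<Longrightarrow> 1 + cb (Suc m) = ca (ca m) + ca (Suc (cb m))"
  using ca_Suc_rec[of m] ca_add_cb[of m] ca_add_cb[of "Suc m"] ca_add_cb[of "ca m"]
    ca_add_cb[of "Suc (cb m)"] by linarith

text \<open>The left side counts the factors \<open>ab\<close>, and \<open>cb (Suc (cb m))\<close> the factors \<open>ba\<close>, in the
  prefix of length \<open>m + 1\<close>.\<close>

lemma ab_eq_ba: "1 \<le> m \<Longrightarrow> ca (ca m) = cb (Suc (cb m)) + (if wd (Suc m) then 0 else 1)"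
proof (induction m rule: dec_induct)
  case base
  then show ?case using wd_numerals wd_1 by (simp add: numeral_eq_Suc ca_Suc cb_Suc)
next
  case (step m)
  show ?case
  proof (cases "wd (Suc m)")
    case True
    then have "ca (Suc m) = Suc (ca m)" "cb (Suc m) = cb m"
      "wd (Suc (Suc m)) = (\<not> wd (Suc (ca m)))"
      using wd_Suc_a[of "Suc m"] by (simp_all add: ca_Suc cb_Suc)
    with step.IH True show ?thesis by (simp add:  ca_Suc[of "ca m"] cb_Suc[of "ca m"])
  next
    case False
    then have "ca (Suc m) = ca m" "cb (Suc m) = Suc (cb m)"
      "wd (Suc (Suc m)) = (\<not> wd (Suc (Suc (cb m))))"
      using wd_Suc_b[of "Suc m"] by (simp_all add: ca_Suc cb_Suc)
    with step.IH False show ?thesis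
      by (simp add:  ca_Suc[of "Suc (cb m)"] cb_Suc[of "Suc (cb m)"])
  qed
qed

text \<open>Were \<open>ca\<close> bounded, \<open>cb\<close> would grow and
  \<open>ca_Suc_rec\<close> would push \<open>ca\<close> up again. This makes the LEAST in
  \<open>LA\<close> and \<open>LB\<close> meaningful.\<close>

lemma ca_cb_unbounded: "\<exists>v. n \<le> ca v \<and> n \<le> cb v"
proof -
  have A: "\<exists>v. n \<le> ca v" for n
  proof (rule ccontr)
    assume "\<nexists>v. n \<le> ca v"
    then have lt: "ca v < n" for v by (meson not_le)
    have big: "k \<le> cb (n + k)" for k using ca_add_cb[of "n + k"] lt[of "n + k"] by linarith
    have "n \<le> cb (n + n)" by (rule big)
    also have "\<dots> \<le> cb (Suc (cb (n + (n + n))))" using big[of "n + n"] by (intro cb_mono) simp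
    also have "\<dots> \<le> ca (Suc (n + (n + n)))"
      using ca_Suc_rec[of "n + (n + n)"] lt[of 0] by simp
    finally show False using lt by (meson not_le)
  qed
  have B: "\<exists>v. n \<le> cb v" for n
  proof -
    obtain u where u: "n + 1 \<le> ca u" using A by blast
    obtain v where v: "u + 1 \<le> ca v" using A by blast
    have "v \<ge> 1" using v by (cases v) auto
    have "n + 1 \<le> ca (ca v)" using ca_mono[of u "ca v"] u v by simp
    then have "n \<le> cb (Suc v)" using cb_Suc_rec[of v] \<open>v \<ge> 1\<close> by simp
    then show ?thesis by blast
  qed
  obtain u v where "n \<le> ca u" "n \<le> cb v" using A B by blast
  then have "n \<le> ca (max u v)" "n \<le> cb (max u v)"
    using ca_mono[of u "max u v"] cb_mono[of v "max u v"] by auto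
  then show ?thesis by blast
qed

text \<open>The \<open>(i + 1)\<close>-th \<open>a\<close> is at position \<open>LA i + 1\<close>, but the \<open>i\<close>-th \<open>b\<close> at position \<open>LB i + 1\<close>.\<close>

definition LA :: "nat \<Rightarrow> nat" where "LA i = (LEAST v. Suc i \<le> ca (Suc v))"
definition LB :: "nat \<Rightarrow> nat" where "LB i = (LEAST v. i \<le> cb (Suc v))"

lemma ca_le_iff: "ca v \<le> i \<longleftrightarrow> v \<le> LA i"
proof -
  obtain u where "Suc i \<le> ca u" using ca_cb_unbounded by blast
  then have ex: "Suc i \<le> ca (Suc u)" using ca_mono[of u "Suc u"] by simp
  have 1: "Suc i \<le> ca (Suc (LA i))" unfolding LA_def by (rule LeastI, rule ex)
  have 2: "Suc i \<le> ca (Suc u) \<Longrightarrow> LA i \<le> u" for u unfolding LA_def by (rule Least_le)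
  show ?thesis
  proof
    assume "ca v \<le> i"
    then show "v \<le> LA i" using 1 ca_mono[of "Suc (LA i)" v] by linarith
  next
    assume "v \<le> LA i"
    then show "ca v \<le> i" using 2[of "v - 1"] by (cases v) (auto simp: not_less_eq_eq[symmetric])
  qed
qed

lemma cb_less_iff: "1 \<le> i \<Longrightarrow> cb v < i \<longleftrightarrow> v \<le> LB i"
proof -
  assume "1 \<le> i"
  obtain u where "i \<le> cb u" using ca_cb_unbounded by blast
  then have ex: "i \<le> cb (Suc u)" using cb_mono[of u "Suc u"] by simp
  have 1: "i \<le> cb (Suc (LB i))" unfolding LB_def by (rule LeastI, rule ex)
  have 2: "i \<le> cb (Suc u) \<Longrightarrow> LB i \<le> u" for u unfolding LB_def by (rule Least_le)
  show ?thesis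
  proof
    assume "cb v < i"
    then show "v \<le> LB i" using 1 cb_mono[of "Suc (LB i)" v] by linarith
  next
    assume "v \<le> LB i"
    then show "cb v < i" using 2[of "v - 1"] \<open>1 \<le> i\<close> by (cases v) (auto simp: not_le[symmetric])
  qed
qed

lemma LA_props: "ca (LA i) = i" "wd (Suc (LA i))"
  using ca_le_iff[of "LA i" i] ca_le_iff[of "Suc (LA i)" i] ca_Suc[of "LA i"]
  by (auto split: if_splits)

lemma LB_props: "1 \<le> i \<Longrightarrow> Suc (cb (LB i)) = i" "1 \<le> i \<Longrightarrow> \<not> wd (Suc (LB i))"
  using cb_less_iff[of i "LB i"] cb_less_iff[of i "Suc (LB i)"] cb_Suc[of "LB i"]
  by (auto split: if_splits)

lemma LA_eqI: "ca v = i \<Longrightarrow> wd (Suc v) \<Longrightarrow> LA i = v"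
  using ca_le_iff[of v i] ca_le_iff[of "Suc v" i] ca_Suc[of v] by auto

lemma LB_eqI: "Suc (cb v) = i \<Longrightarrow> \<not> wd (Suc v) \<Longrightarrow> LB i = v"
  using cb_less_iff[of i v] cb_less_iff[of i "Suc v"] cb_Suc[of v] by auto

lemma LA_0 [simp]: "LA 0 = 0"
  by (rule LA_eqI) (auto simp: wd_1)

lemma LB_0 [simp]: "LB 0 = 0"
  by (simp add: LB_def)

text \<open>Split the position as \<open>v = ca v + cb v\<close> with \<open>ca v = i\<close>.
  Letter \<open>Suc (cb v)\<close> is a b, and \<open>ab_eq_ba\<close> shows that it is number
  \<open>ca i\<close> among the b's, so \<open>cb v = LB (ca i)\<close>.\<close>

lemma LA_rec: "LA i = i + LB (ca i)"
proof (cases "i = 0")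
  case False
  define v where "v = LA i"
  have v: "ca v = i" "wd (Suc v)" using LA_props by (auto simp: v_def)
  have "v \<noteq> 0" using v(1) False by (intro notI) simp
  moreover have "v \<noteq> 1" using v(2) wd_numerals(1) by (intro notI) (simp add: numeral_2_eq_2)
  ultimately have v2: "2 \<le> v" by linarith
  have nb: "\<not> wd (Suc (cb v))" using wd_cb_before_a v2 v by blast
  have "ca i = cb (Suc (cb v))" using ab_eq_ba[of v] v v2 by simp
  then have "LB (ca i) = cb v" using nb by (intro LB_eqI) (auto simp: cb_Suc)
  then show ?thesis using ca_add_cb[of v] v by (simp add: v_def)
qed simp

text \<open>Here letter \<open>ca v\<close> is an a and, by \<open>ab_eq_ba\<close>, number
  \<open>Suc (cb i)\<close> among the a's.\<close>

lemma LB_rec: "LB i = i + LA (cb i)"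
proof (cases "i = 0")
  case False
  define v where "v = LB i"
  have v: "Suc (cb v) = i" "\<not> wd (Suc v)" using LB_props False by (auto simp: v_def)
  have v1: "1 \<le> v" using v wd_1 by (cases v) auto
  have nb: "wd (ca v)" using wd_ca_before_b v1 v by blast
  obtain x where x: "ca v = Suc x" using ca_pos[OF v1] by (cases "ca v") auto
  have "ca (ca v) = Suc (cb i)" using ab_eq_ba[of v] v v1 by simp
  then have "LA (cb i) = x" using nb x by (intro LA_eqI) (auto simp: ca_Suc)
  then show ?thesis using ca_add_cb[of v] v x by (simp add: v_def)
qed simp

text \<open>The Jacobsthal numbers.\<close>

fun J :: "nat \<Rightarrow> nat" where
  "J 0 = 0"
| "J (Suc 0) = 1"
| "J (Suc (Suc n)) = J (Suc n) + 2 * J n"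

lemma J_add_Suc: "J n + J (Suc n) = 2 ^ n"
  by (induction n) auto

lemma J_parity: "J (2 * n + 1) = 2 * J (2 * n) + 1 \<and> J (2 * n + 2) + 1 = 2 * J (2 * n + 1)"
proof (induction n)
  case (Suc n)
  have "J (2 * Suc n + 1) = J (2 * n + 2) + 2 * J (2 * n + 1)"
    "J (2 * Suc n + 2) = J (2 * Suc n + 1) + 2 * J (2 * n + 2)"
    "J (2 * Suc n) = J (2 * n + 2)"
    by (simp_all add: numeral_2_eq_2)
  with Suc.IH show ?case by linarith
qed simp

lemma J_odd: "J (2 * n + 1) = 2 * J (2 * n) + 1"
  using J_parity by blast

lemma J_even: "J (2 * n + 2) + 1 = 2 * J (2 * n + 1)"
  using J_parity by blast

declare J.simps(3) [simp del]

text \<open>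
  Positions \<open>J (2 * n + 3)\<close> and \<open>J (2 * n + 4)\<close> lie inside long runs of \<open>a\<close> and of \<open>b\<close>, respectively.
\<close>

lemma long_runs:
  "LB (J (2 * n + 2)) + 1 < J (2 * n + 3) \<and> J (2 * n + 3) + 1 \<le> LB (J (2 * n + 2) + 1) \<and>
   LA (J (2 * n + 3) - 1) + 1 < J (2 * n + 4) \<and> J (2 * n + 4) + 1 \<le> LA (J (2 * n + 3))"
proof -
  \<comment> \<open>The gap around one Jacobsthal number is carried to the next:
    \<open>LA_rec\<close> adds a position near \<open>?b\<close> to an \<open>LB\<close> value near
    \<open>?b\<close>, and \<open>?c + 1 = 2 * ?b\<close>.\<close>
  have E2O: "LA (J (2 * n + 3) - 1) + 1 < J (2 * n + 4) \<and> J (2 * n + 4) + 1 \<le> LA (J (2 * n + 3))"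
    if E: "LB (J (2 * n + 2)) + 1 < J (2 * n + 3)" "J (2 * n + 3) + 1 \<le> LB (J (2 * n + 2) + 1)" for n
  proof -
    let ?a = "J (2 * n + 2)" and ?b = "J (2 * n + 3)" and ?c = "J (2 * n + 4)"
    have ja: "?b = 2 * ?a + 1" using J_odd[of "n + 1"] by (simp add: numeral_eq_Suc)
    have jb: "?c + 1 = 2 * ?b" using J_even[of "n + 1"] by (simp add: numeral_eq_Suc)
    have pos: "1 \<le> ?a" using J_even[of n] by (cases "?a") auto
    have "\<not> cb (?b - 1) < ?a" "cb ?b < ?a + 1" 
      using cb_less_iff[of ?a "?b - 1"] cb_less_iff[of "?a + 1" ?b] pos E by auto
    then have "cb (?b - 1) = ?a" "cb ?b = ?a" using cb_mono[of "?b - 1" ?b] by auto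
    then have c: "ca (?b - 1) = ?a" "ca ?b = ?a + 1"
      using ca_add_cb[of ?b] ca_add_cb[of "?b - 1"] ja by auto
    show ?thesis using LA_rec[of "?b - 1"] LA_rec[of ?b] c E ja jb by simp
  qed
  show ?thesis
  proof (induction n)
    case 0
    have "LB 1 = 1" "LB 2 = 4"
      by (rule LB_eqI; use wd_numerals in \<open>simp add: numeral_eq_Suc\<close>)+
    then have "LB (J (2 * 0 + 2)) + 1 < J (2 * 0 + 3)" "J (2 * 0 + 3) + 1 \<le> LB (J (2 * 0 + 2) + 1)"
      by (simp_all add: numeral_eq_Suc J.simps(3))
    with E2O[of 0] show ?case by blast
  next
    case (Suc n)
    let ?a = "J (2 * n + 3)" and ?b = "J (2 * n + 4)" and ?c = "J (2 * n + 5)"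
    have ja: "?b + 1 = 2 * ?a" using J_even[of "n + 1"] by (simp add: numeral_eq_Suc)
    have jb: "?c = 2 * ?b + 1" using J_odd[of "n + 2"] by (simp add: numeral_eq_Suc)
    have E: "LA (?a - 1) + 1 < ?b" "?b + 1 \<le> LA ?a" using Suc by auto
    have "\<not> ca ?b \<le> ?a - 1" "ca (?b + 1) \<le> ?a"
      using ca_le_iff[of ?b "?a - 1"] ca_le_iff[of "?b + 1" ?a] E by auto
    then have "ca ?b = ?a" "ca (?b + 1) = ?a" using ca_mono[of ?b "?b + 1"] ja by auto
    then have c: "cb ?b = ?a - 1" "cb (?b + 1) = ?a"
      using ca_add_cb[of ?b] ca_add_cb[of "?b + 1"] ja by auto
    have "LB ?b + 1 < ?c" "?c + 1 \<le> LB (?b + 1)"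
      using LB_rec[of "?b + 1"] LB_rec[of ?b] c E ja jb by simp_all
    then show ?case using E2O[of "n + 1"] by (simp add: numeral_eq_Suc)
  qed
qed

section \<open>Jacobsthal thresholds and the counts at them\<close>

lemma J_3_4: "J (2 * n + 3) = 2 * J (2 * n + 2) + 1" "J (2 * n + 4) + 1 = 2 * J (2 * n + 3)"
  using J_parity[of "Suc n"] by (simp_all add: algebra_simps numeral_eq_Suc)

lemma J_2: "J 2 = 1" "J (Suc (Suc 0)) = 1"
  by (simp_all add: numeral_2_eq_2 J.simps(3))

lemma J_pos: "1 \<le> n \<Longrightarrow> 1 \<le> J n"
  by (induction n rule: J.induct) (auto simp: J.simps(3))

lemma J_Suc_mono: "J n \<le> J (Suc n)"
  by (cases n) (auto simp: J.simps(3))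

lemma J_mono: "m \<le> n \<Longrightarrow> J m \<le> J n"
  by (rule lift_Suc_mono_le) (auto simp: J_Suc_mono)

text \<open>Keeps the shift below the thresholds, so that subtractions such as \<open>z - s\<close>
  in the closed forms are not truncated.\<close>

lemma J_ge: "s < J (2 * s + 1)" "s < J (2 * s + 2)"
proof -
  show 1: "s < J (2 * s + 1)"
  proof (induction s)
    case (Suc s)
    then show ?case using J_pos[of "2 * s + 2"] by (simp add: J.simps(3))
  qed simp
  show "s < J (2 * s + 2)" using 1 J_mono[of "2 * s + 1" "2 * s + 2"] by linarith
qed

text \<open>That \<open>cb\<close> agrees at \<open>j - 1\<close> and \<open>j\<close> is what makes
  two consecutive shifts give the same value at a threshold.\<close>

lemma run_odd:
  fixes n defines "j \<equiv> J (2 * n + 3)"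
  shows "cb (j - 1) = J (2 * n + 2)" "cb j = J (2 * n + 2)" "cb (j + 1) = J (2 * n + 2)"
    "wd j" "wd (j + 1)"
proof -
  let ?a = "J (2 * n + 2)"
  have pos: "1 \<le> ?a" "1 \<le> j" using J_pos by (simp_all add: j_def del: One_nat_def)
  have lr: "LB ?a + 1 < j" "j + 1 \<le> LB (?a + 1)" using long_runs[of n] by (auto simp: j_def)
  have "\<not> cb (j - 1) < ?a" using cb_less_iff[of ?a "j - 1"] pos lr by linarith
  moreover have "cb (j + 1) < ?a + 1" using cb_less_iff[of "?a + 1" "j + 1"] lr by linarith
  moreover have "cb (j - 1) \<le> cb j" "cb j \<le> cb (j + 1)" by (rule cb_mono, simp)+
  ultimately show *: "cb (j - 1) = ?a" "cb j = ?a" "cb (j + 1) = ?a" by linarith+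
  show "wd j" "wd (j + 1)" using cb_Suc[of "j - 1"] cb_Suc[of j] * pos by (auto split: if_splits)
qed

lemma run_even:
  fixes n defines "j \<equiv> J (2 * n + 4)"
  shows "ca (j - 1) = J (2 * n + 3)" "ca j = J (2 * n + 3)" "ca (j + 1) = J (2 * n + 3)"
    "\<not> wd j" "\<not> wd (j + 1)"
proof -
  let ?a = "J (2 * n + 3)"
  have pos: "1 \<le> ?a" "1 \<le> j" using J_pos by (simp_all add: j_def del: One_nat_def)
  have lr: "LA (?a - 1) + 1 < j" "j + 1 \<le> LA ?a" using long_runs[of n] by (auto simp: j_def)
  have "\<not> ca (j - 1) \<le> ?a - 1" using ca_le_iff[of "j - 1" "?a - 1"] pos lr by linarith
  moreover have "ca (j + 1) \<le> ?a" using ca_le_iff[of "j + 1" ?a] lr by linarith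
  moreover have "ca (j - 1) \<le> ca j" "ca j \<le> ca (j + 1)" by (rule ca_mono, simp)+
  ultimately show *: "ca (j - 1) = ?a" "ca j = ?a" "ca (j + 1) = ?a" by linarith+
  show "\<not> wd j" "\<not> wd (j + 1)" using ca_Suc[of "j - 1"] ca_Suc[of j] * pos by (auto split: if_splits)
qed

lemma counts_J_odd: "cb (J (2 * s + 1)) = J (2 * s)" "ca (J (2 * s + 1)) = J (2 * s) + 1"
proof -
  show 1: "cb (J (2 * s + 1)) = J (2 * s)"
  proof (cases s)
    case 0
    then show ?thesis using wd_numerals(11) by simp
  next
    case (Suc n)
    then show ?thesis using run_odd(2)[of n] by (simp add: numeral_3_eq_3)
  qed
  show "ca (J (2 * s + 1)) = J (2 * s) + 1"
    using 1 ca_add_cb[of "J (2 * s + 1)"] J_odd[of s] by linarith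
qed

lemma counts_J_even: "ca (J (2 * s + 2)) = J (2 * s + 1)" "cb (J (2 * s + 2)) + 1 = J (2 * s + 1)"
proof -
  show 1: "ca (J (2 * s + 2)) = J (2 * s + 1)"
  proof (cases s)
    case 0
    then show ?thesis using wd_numerals(6) by (simp add: J_2)
  next
    case (Suc n)
    then show ?thesis using run_even(2)[of n] by (simp add: numeral_eq_Suc)
  qed
  show "cb (J (2 * s + 2)) + 1 = J (2 * s + 1)"
    using 1 ca_add_cb[of "J (2 * s + 2)"] J_even[of s] by linarith
qed

section \<open>Closed form of the sequence\<close>

text \<open>An odd index minus an odd value is even, so odd-indexed terms come from even-indexed
  ones. Positivity of \<open>x\<close> and \<open>y\<close> gives the upper bounds of the range
  test.\<close>

lemma Qt_odd_step:
  assumes "1 \<le> m" "Qt (2 * m) = 2 * int b + 1" "Qt (2 * m - 1) = 2 * int a - 1" "1 \<le> a"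
    "x + b = m" "1 \<le> x" "y + a = m + 1" "1 \<le> y"
    "Qt (2 * x) = 2 * int p + 1" "Qt (2 * y) = 2 * int q + 1"
  shows "Qt (2 * m + 1) = 2 * int (p + q) + 1"
proof -
  have "nat (Qt (2 * m)) = 2 * b + 1" "nat (Qt (2 * m - 1)) = 2 * a - 1"
    using assms(2,3) by linarith+
  then have "2 * m + 1 - nat (Qt (2 * m)) = 2 * x" "2 * m + 1 - nat (Qt (2 * m - 1)) = 2 * y"
    using assms by linarith+
  then show ?thesis using Qt_rec[of "2 * m + 1"] assms by simp
qed

lemma Qt_even_step:
  assumes "1 \<le> m" "Qt (2 * m + 1) = 2 * int a - 1" "Qt (2 * m) = 2 * int b + 1" "1 \<le> a"
    "x + a = m + 2" "1 \<le> x" "y + b = m + 1" "1 \<le> y"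
    "Qt (2 * x - 1) = 2 * int p - 1" "Qt (2 * y - 1) = 2 * int q - 1"
  shows "Qt (2 * m + 2) = 2 * int (p + q) - 1"
proof -
  have "nat (Qt (2 * m + 1)) = 2 * a - 1" "nat (Qt (2 * m)) = 2 * b + 1"
    using assms(2,3) by linarith+
  then have "2 * m + 2 - nat (Qt (2 * m + 1)) = 2 * x - 1" "2 * m + 2 - nat (Qt (2 * m)) = 2 * y - 1"
    using assms by linarith+
  then show ?thesis using Qt_rec[of "2 * m + 2"] assms by simp
qed

text \<open>
  The ranges of admissible \<open>s\<close> overlap; on the overlaps the count is constant because of the long runs.
\<close>

definition odd_closed :: "nat \<Rightarrow> bool" where
  "odd_closed m \<longleftrightarrow> (\<forall>s. J (2 * s + 2) \<le> m + s \<and> m + s \<le> J (2 * s + 4) \<longrightarrow>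
     Qt (2 * m - 1) = 2 * int (ca (m + s)) - 1)"

definition even_closed :: "nat \<Rightarrow> bool" where
  "even_closed m \<longleftrightarrow> (\<forall>s. J (2 * s + 1) \<le> m + s \<and> m + s \<le> J (2 * s + 3) \<longrightarrow>
     Qt (2 * m) = 2 * int (cb (m + s)) + 1)"

lemma odd_closedD: "odd_closed m \<Longrightarrow> J (2 * s + 2) \<le> m + s \<Longrightarrow> m + s \<le> J (2 * s + 4) \<Longrightarrow>
    Qt (2 * m - 1) = 2 * int (ca (m + s)) - 1"
  by (simp add: odd_closed_def)

lemma even_closedD: "even_closed m \<Longrightarrow> J (2 * s + 1) \<le> m + s \<Longrightarrow> m + s \<le> J (2 * s + 3) \<Longrightarrow>
    Qt (2 * m) = 2 * int (cb (m + s)) + 1"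
  by (simp add: even_closed_def)

lemma odd_closed_Suc:
  assumes m: "1 \<le> m" and IH: "\<And>i. 1 \<le> i \<Longrightarrow> i \<le> m \<Longrightarrow> odd_closed i \<and> even_closed i"
  shows "odd_closed (Suc m)"
proof -
  have main: "Qt (2 * m + 1) = 2 * int (ca (Suc m + s)) - 1"
    if lo: "J (2 * s + 2) < Suc m + s" and hi: "Suc m + s \<le> J (2 * s + 4)" for s
  proof -
    define M where "M = m + s"
    have M1: "1 \<le> M" using m by (simp add: M_def)
    have B: "Qt (2 * (z - s)) = 2 * int (cb z) + 1" if "J (2 * s + 1) \<le> z" "z \<le> J (2 * s + 3)" "z \<le> M" for z
      using even_closedD[of "z - s" s] IH[of "z - s"] J_ge(1)[of s] that by (simp add: M_def)
    have ltM: "J (2 * s + 2) \<le> M" "M < J (2 * s + 4)" using lo hi by (auto simp: M_def)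
    have Am: "Qt (2 * m - 1) = 2 * int (ca M) - 1"
      using odd_closedD[of m s] IH[of m] ltM m by (simp add: M_def)
    have aM: "1 \<le> ca M" using ca_pos M1 by blast
    have sum: "ca M + cb M = M" "ca (Suc M) + cb (Suc M) = Suc M" by (rule ca_add_cb)+
    have rec: "ca (Suc M) = 1 + cb (ca M) + cb (Suc (cb M))" using ca_Suc_rec M1 by blast
    have js: "s < J (2 * s + 1)" by (rule J_ge)
    have "Qt (2 * m + 1) = 2 * int (ca (Suc M)) - 1"
    proof (cases "M \<le> J (2 * s + 3)")
      case True
      have Bm: "Qt (2 * m) = 2 * int (cb M) + 1"
        using even_closedD[of m s] IH[of m] ltM m True J_mono[of "2 * s + 1" "2 * s + 2"]
        by (simp add: M_def)
      have ranges: "J (2 * s + 1) \<le> ca M" "J (2 * s + 1) \<le> Suc (cb M)"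
        using ca_mono[OF ltM(1)] cb_mono[OF ltM(1)] counts_J_even[of s] by simp_all
      have "Suc (cb M) \<le> M" using cb_less[OF M1] by simp
      then have "Qt (2 * (ca M - s)) = 2 * int (cb (ca M)) + 1"
        "Qt (2 * (Suc (cb M) - s)) = 2 * int (cb (Suc (cb M))) + 1"
        using B[of "ca M"] B[of "Suc (cb M)"] ranges ca_le[of M] True by simp_all
      then have "Qt (2 * m + 1) = 2 * int (cb (ca M) + cb (Suc (cb M))) + 1"
        using Qt_odd_step[OF m Bm Am aM, of "ca M - s" "Suc (cb M) - s"] sum ranges js
        by (simp add: M_def)
      then show ?thesis using rec by simp
    next
      case False
      have Bm: "Qt (2 * m) = 2 * int (cb (Suc M)) + 1"
        using even_closedD[of m "Suc s"] IH[of m] ltM m False J_mono[of "2 * s + 4" "2 * s + 5"]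
        by (simp add: M_def numeral_eq_Suc)
      have lo1: "J (2 * s + 2) < ca (Suc M)" "J (2 * s + 2) < Suc (cb M)"
        using ca_mono[of "J (2 * s + 3)" "Suc M"] cb_mono[of "J (2 * s + 3)" M] counts_J_odd[of "Suc s"] False
        by (simp_all add: numeral_3_eq_3)
      have hi1: "ca (Suc M) \<le> J (2 * s + 3)" "Suc (cb M) \<le> J (2 * s + 3)"
        using ca_mono[of "Suc M" "J (2 * s + 4)"] cb_mono[of M "J (2 * s + 4)"]
          counts_J_even[of "Suc s"] ltM by (simp_all add: numeral_eq_Suc)
      have jj: "J (2 * s + 1) \<le> J (2 * s + 2)" by (rule J_mono) simp
      have "Suc (cb M) \<le> M" using cb_less[OF M1] by simp
      then have 1: "Qt (2 * (ca (Suc M) - 1 - s)) = 2 * int (cb (ca (Suc M) - 1)) + 1"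
        "Qt (2 * (Suc (cb M) - s)) = 2 * int (cb (Suc (cb M))) + 1"
        using B[of "ca (Suc M) - 1"] B[of "Suc (cb M)"] lo1 hi1 jj ca_le[of "Suc M"] by simp_all
      \<comment> \<open>The larger shift in \<open>Bm\<close> moves a lookup from
        \<open>ca M\<close> to \<open>ca (Suc M) - 1\<close>; these coincide or differ by dropping
        an a, which \<open>cb\<close> does not see.\<close>
      have "cb (ca (Suc M) - 1) = cb (ca M)"
      proof (cases "wd (Suc M)")
        case True
        then show ?thesis by (simp add: ca_Suc)
      next
        case False
        then have "wd (ca M)" using wd_ca_before_b M1 by blast
        then show ?thesis using False cb_Suc[of "ca M - 1"] aM by (simp add: ca_Suc)
      qed
      moreover have "Qt (2 * m + 1) = 2 * int (cb (ca (Suc M) - 1) + cb (Suc (cb M))) + 1"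
        using Qt_odd_step[OF m Bm Am aM _ _ _ _ 1] sum lo1 jj js
        by (simp add: M_def)
      ultimately show ?thesis using rec by simp
    qed
    then show ?thesis by (simp add: M_def)
  qed
  show ?thesis unfolding odd_closed_def
  proof (intro allI impI)
    fix s assume s: "J (2 * s + 2) \<le> Suc m + s \<and> Suc m + s \<le> J (2 * s + 4)"
    show "Qt (2 * Suc m - 1) = 2 * int (ca (Suc m + s)) - 1"
    proof (cases "J (2 * s + 2) < Suc m + s")
      case True
      then show ?thesis using main s by simp
    next
      case False
      then have eq: "J (2 * s + 2) = Suc m + s" using s by simp
      \<comment> \<open>At the threshold itself the preceding shift \<open>t\<close> still applies,
        and the long run of b yields the same \<open>ca\<close>. Shift 0 is impossible here since
        \<open>J 2 = 1\<close>.\<close>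
      then obtain t where t: "s = Suc t" using m by (cases s) (auto simp: J_2)
      have e4: "J (2 * t + 4) = Suc m + s" using eq t by (simp add: numeral_eq_Suc)
      have "J (2 * t + 2) + 1 < J (2 * t + 4)"
        using J_3_4[of t] J_pos[of "2 * t + 2"] by linarith
      then have "Qt (2 * m + 1) = 2 * int (ca (Suc m + t)) - 1"
        using main[of t] e4 t by simp
      moreover have "ca (Suc m + t) = ca (Suc m + s)"
        using run_even(1,2)[of t] e4 t by simp
      ultimately show ?thesis by simp
    qed
  qed
qed

lemma even_closed_Suc:
  assumes m: "1 \<le> m" and IH: "\<And>i. 1 \<le> i \<Longrightarrow> i \<le> m \<Longrightarrow> odd_closed i \<and> even_closed i"
    and IH': "odd_closed (Suc m)"
  shows "even_closed (Suc m)"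
proof -
  have IA: "odd_closed i" if "1 \<le> i" "i \<le> Suc m" for i
    using IH IH' that by (cases "i = Suc m") auto
  have main: "Qt (2 * m + 2) = 2 * int (cb (Suc m + s)) + 1"
    if lo: "J (2 * s + 1) < Suc m + s" and hi: "Suc m + s \<le> J (2 * s + 3)" for s
  proof -
    define M where "M = m + s"
    have M1: "1 \<le> M" using m by (simp add: M_def)
    have ltM: "J (2 * s + 1) \<le> M" "M < J (2 * s + 3)" using lo hi by (auto simp: M_def)
    have Bm: "Qt (2 * m) = 2 * int (cb M) + 1"
      using even_closedD[of m s] IH[of m] ltM m by (simp add: M_def)
    have sum: "ca M + cb M = M" "ca (Suc M) + cb (Suc M) = Suc M" by (rule ca_add_cb)+
    have rec: "1 + cb (Suc M) = ca (ca M) + ca (Suc (cb M))" using cb_Suc_rec M1 by blast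
    have "Qt (2 * m + 2) = 2 * int (cb (Suc M)) + 1"
    proof (cases "J (2 * s + 2) \<le> M")
      case True
      have Am: "Qt (2 * m + 1) = 2 * int (ca (Suc M)) - 1"
        using odd_closedD[OF IH', of s] ltM True J_mono[of "2 * s + 3" "2 * s + 4"]
        by (simp add: M_def)
      \<comment> \<open>The lookups fall into the range of shift \<open>s - 1\<close>. For
        \<open>s = 0\<close> there is no such shift; then \<open>z = 1\<close> is forced, and the
        closed form at 2 serves because \<open>ca 2 = ca 1\<close>.\<close>
      have h: "Qt (2 * (z + 1 - s) - 1) = 2 * int (ca z) - 1"
        if "J (2 * s) \<le> z" "1 \<le> z" "z \<le> J (2 * s + 2)" "z \<le> M" for z
      proof (cases s)
        case 0
        then have "z = 1" using that by (simp add: J_2)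
        then show ?thesis
          using odd_closedD[of 2 0] IA[of 2] m wd_numerals(6,7) J_3_4[of 0] 0 by (simp add: J_2)
      next
        case (Suc t)
        have "t < J (2 * t + 2)" by (rule J_ge)
        moreover have "J (2 * t + 2) \<le> z" "z \<le> J (2 * t + 4)"
          using that Suc by (simp_all add: numeral_eq_Suc)
        moreover have "z - t \<le> Suc m" using that Suc by (simp add: M_def)
        ultimately show ?thesis using odd_closedD[of "z - t" t] IA[of "z - t"] Suc by simp
      qed
      have jj: "J (2 * s) \<le> J (2 * s + 1)" "J (2 * s + 1) = 2 * J (2 * s) + 1"
        by (auto intro: J_mono simp only: J_odd)
      have r1: "J (2 * s + 1) \<le> ca M" "J (2 * s + 1) \<le> cb (Suc M) + 1"
        using ca_mono[OF True] cb_mono[of "J (2 * s + 2)" "Suc M"] True counts_J_even[of s] by simp_all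
      have "cb 2 \<le> cb (Suc M)" using M1 by (intro cb_mono) simp
      then have r2: "1 \<le> cb (Suc M)" "1 \<le> ca M" using ca_pos[OF M1] wd_numerals(12) by simp_all
      have r3: "J (2 * s) \<le> cb (Suc M)" using r1 r2 jj by linarith
      have r4: "cb (Suc M) \<le> J (2 * s + 2)"
        using cb_mono[of "Suc M" "J (2 * s + 3)"] run_odd(2)[of s] ltM by simp
      have "M \<le> J (2 * s + 3) - 1" using ltM by simp
      then have "ca M \<le> ca (J (2 * s + 3) - 1)" by (rule ca_mono)
      then have r5: "ca M \<le> J (2 * s + 2)"
        using run_odd(1)[of s] ca_add_cb[of "J (2 * s + 3) - 1"] J_3_4(1)[of s] by linarith
      have "cb (Suc M) \<le> M" using cb_less[of "Suc M"] by simp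
      then have 1: "Qt (2 * (cb (Suc M) + 1 - s) - 1) = 2 * int (ca (cb (Suc M))) - 1"
        "Qt (2 * (ca M + 1 - s) - 1) = 2 * int (ca (ca M)) - 1"
        using h[of "cb (Suc M)"] h[of "ca M"] r1 r2 r3 r4 r5 jj ca_le[of M] by linarith+
      \<comment> \<open>If \<open>cb (Suc M)\<close> and \<open>Suc (cb M)\<close> differ, the extra
        letter is a b and leaves \<open>ca\<close> unchanged.\<close>
      have eq: "ca (cb (Suc M)) = ca (Suc (cb M))"
      proof (cases "wd (Suc M)")
        case False
        then show ?thesis by (simp add: cb_Suc)
      next
        case True
        then have "M \<noteq> 1" using wd_numerals(1) by (intro notI) (simp add: numeral_2_eq_2)
        then have "\<not> wd (Suc (cb M))" using wd_cb_before_a[of M] M1 True by simp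
        then show ?thesis using True by (simp add: cb_Suc ca_Suc)
      qed
      have "s < J (2 * s + 1)" by (rule J_ge)
      then have "Qt (2 * m + 2) = 2 * int (ca (cb (Suc M)) + ca (ca M)) - 1"
        using Qt_even_step[OF m Am Bm _ _ _ _ _ 1] sum r1 ca_pos[of "Suc M"] by (simp add: M_def)
      then show ?thesis using rec eq by simp
    next
      case False
      then obtain t where t: "s = Suc t" using M1 by (cases s) (auto simp: J_2)
      have ltM': "J (2 * t + 3) \<le> M" "M < J (2 * t + 4)"
        using ltM False t by (simp_all add: numeral_eq_Suc)
      have mM: "M = Suc m + t" using t by (simp add: M_def)
      have jj: "J (2 * t + 2) \<le> J (2 * t + 3)" by (rule J_mono) simp
      have Am: "Qt (2 * m + 1) = 2 * int (ca M) - 1"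
        using odd_closedD[OF IH', of t] ltM' jj by (simp add: mM)
      have h: "Qt (2 * (z - t) - 1) = 2 * int (ca z) - 1"
        if "J (2 * t + 2) \<le> z" "z \<le> M" for z
        using odd_closedD[of "z - t" t] IA[of "z - t"] that ltM' J_ge(2)[of t] by (simp add: mM)
      have r: "J (2 * t + 2) < ca M" "J (2 * t + 2) < Suc (cb M)"
        using ca_mono[OF ltM'(1)] cb_mono[OF ltM'(1)] counts_J_odd[of "Suc t"]
        by (simp_all add: numeral_3_eq_3)
      have "Suc (cb M) \<le> M" using cb_less[OF M1] by simp
      then have 1: "Qt (2 * (Suc (cb M) - t) - 1) = 2 * int (ca (Suc (cb M))) - 1"
        "Qt (2 * (ca M - t) - 1) = 2 * int (ca (ca M)) - 1"
        using h[of "ca M"] h[of "Suc (cb M)"] r ca_le[of M] by simp_all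
      have "t < J (2 * t + 2)" by (rule J_ge)
      then have "Qt (2 * m + 2) = 2 * int (ca (Suc (cb M)) + ca (ca M)) - 1"
        using Qt_even_step[OF m Am Bm _ _ _ _ _ 1] sum r mM by simp
      then show ?thesis using rec by simp
    qed
    then show ?thesis by (simp add: M_def)
  qed
  show ?thesis unfolding even_closed_def
  proof (intro allI impI)
    fix s assume s: "J (2 * s + 1) \<le> Suc m + s \<and> Suc m + s \<le> J (2 * s + 3)"
    show "Qt (2 * Suc m) = 2 * int (cb (Suc m + s)) + 1"
    proof (cases "J (2 * s + 1) < Suc m + s")
      case True
      then show ?thesis using main s by simp
    next
      case False
      then have eq: "J (2 * s + 1) = Suc m + s" using s by simp
      then obtain t where t: "s = Suc t" using m by (cases s) auto
      have e4: "J (2 * t + 3) = Suc m + s" using eq t by (simp add: numeral_eq_Suc)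
      have "J (2 * t + 1) + 1 < J (2 * t + 3)"
        using J_3_4(1)[of t] J_even[of t] J_pos[of "2 * t + 1"] J_pos[of "2 * t + 2"] by linarith
      then have "Qt (2 * m + 2) = 2 * int (cb (Suc m + t)) + 1"
        using main[of t] e4 t by simp
      moreover have "cb (Suc m + t) = cb (Suc m + s)"
        using run_odd(1,2)[of t] e4 t by simp
      ultimately show ?thesis by simp
    qed
  qed
qed

lemma Qt_closed_form: "1 \<le> m \<Longrightarrow> odd_closed m \<and> even_closed m"
proof (induction m rule: less_induct)
  case (less m)
  show ?case
  proof (cases "m = 1")
    case True
    \<comment> \<open>The thresholds outgrow the shift, so only shift 0 is admissible at
      \<open>m = 1\<close>.\<close>
    have "s = 0" if "J (2 * s + 1) \<le> Suc s \<or> J (2 * s + 2) \<le> Suc s" for s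
    proof (cases s)
      case (Suc t)
      have "t < J (2 * t + 1)" by (rule J_ge)
      moreover have "1 \<le> J (2 * t + 2)" by (rule J_pos) simp
      moreover have "J (2 * s + 1) \<le> J (2 * s + 2)" by (rule J_mono) simp
      moreover have "J (2 * s + 1) = J (2 * t + 2) + 2 * J (2 * t + 1)"
        using Suc J.simps(3)[of "2 * t + 1"] by simp
      ultimately show ?thesis using that Suc by linarith
    qed simp
    then show ?thesis using True Qt_1 Qt_2 wd_numerals(6,11)
      unfolding odd_closed_def even_closed_def by fastforce
  next
    case False
    then obtain n where n: "m = Suc n" "1 \<le> n" using less.prems by (cases m) auto
    then have IH: "odd_closed i \<and> even_closed i" if "1 \<le> i" "i \<le> n" for i
      using less.IH that by simp
    show ?thesis using odd_closed_Suc[OF n(2) IH] even_closed_Suc[OF n(2) IH] n(1) by blast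
  qed
qed

lemma A_eq_ca: "1 \<le> m \<Longrightarrow> J (2 * s + 2) \<le> m + s \<Longrightarrow> m + s \<le> J (2 * s + 4) \<Longrightarrow> A m = int (ca (m + s))"
  using odd_closedD[of m s] Qt_closed_form[of m] by (simp add: A_def)

lemma B_eq_cb: "1 \<le> m \<Longrightarrow> J (2 * s + 1) \<le> m + s \<Longrightarrow> m + s \<le> J (2 * s + 3) \<Longrightarrow>
    B m = int (cb (m + s)) + 1"
  using even_closedD[of m s] Qt_closed_form[of m] by (simp add: B_def)

section \<open>Frequencies\<close>

text \<open>These are the positions where shift \<open>s\<close> is admissible for \<open>A\<close>;
  the strict upper bound leaves room for \<open>Suc (LA i)\<close>.\<close>

lemma LA_bounds:
  assumes "J (2 * s + 1) \<le> i" "i < J (2 * s + 3)"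
  shows "J (2 * s + 2) \<le> LA i" "LA i < J (2 * s + 4)"
  using ca_le_iff[of "J (2 * s + 2)" i] ca_le_iff[of "J (2 * s + 4)" i]
    counts_J_even(1)[of s] run_even(2)[of s] assms by linarith+

lemma LB_bounds:
  assumes "J (2 * s) < i" "i \<le> J (2 * s + 2)"
  shows "J (2 * s + 1) \<le> LB i" "LB i < J (2 * s + 3)"
  using cb_less_iff[of i "J (2 * s + 1)"] cb_less_iff[of i "J (2 * s + 3)"]
    counts_J_odd(1)[of s] run_odd(2)[of s] assms by linarith+

lemma ex_A_shift: "1 \<le> m \<Longrightarrow> \<exists>s. J (2 * s + 2) \<le> m + s \<and> m + s < J (2 * s + 4)"
proof (induction m rule: dec_induct)
  case base
  show ?case using J_3_4[of 0] by (intro exI[of _ 0]) (simp add: J_2)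
next
  case (step m)
  then obtain s where s: "J (2 * s + 2) \<le> m + s" "m + s < J (2 * s + 4)" by blast
  show ?case
  proof (cases "Suc m + s < J (2 * s + 4)")
    case True
    then show ?thesis using s by (intro exI[of _ s]) simp
  next
    case False
    have "J (2 * Suc s + 2) = J (2 * s + 4)" by (simp add: numeral_eq_Suc)
    then show ?thesis using s False J_3_4[of "Suc s"] J_pos[of "2 * s + 4"]
      by (intro exI[of _ "Suc s"]) simp
  qed
qed

lemma ex_B_shift: "1 \<le> m \<Longrightarrow> \<exists>s. J (2 * s + 1) \<le> m + s \<and> m + s < J (2 * s + 3)"
proof (induction m rule: dec_induct)
  case base
  show ?case using J_3_4[of 0] by (intro exI[of _ 0]) (simp add: J_2)
next
  case (step m)
  then obtain s where s: "J (2 * s + 1) \<le> m + s" "m + s < J (2 * s + 3)" by blast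
  show ?case
  proof (cases "Suc m + s < J (2 * s + 3)")
    case True
    then show ?thesis using s by (intro exI[of _ s]) simp
  next
    case False
    have "J (2 * Suc s + 1) = J (2 * s + 3)" "J (2 * Suc s + 2) = J (2 * s + 4)"
      by (simp_all add: numeral_eq_Suc)
    then show ?thesis using s False J_3_4(1)[of "Suc s"] J_3_4(2)[of s] J_pos[of "2 * s + 3"]
      by (intro exI[of _ "Suc s"]) simp
  qed
qed

text \<open>The upper bound in \<open>ex_A_shift\<close> is strict, so \<open>n\<close> and
  \<open>Suc n\<close> share a shift.\<close>

lemma A_mono: "m \<le> n \<Longrightarrow> 1 \<le> m \<Longrightarrow> A m \<le> A n"
proof (induction n rule: dec_induct)
  case (step n)
  then obtain s where s: "J (2 * s + 2) \<le> n + s" "n + s < J (2 * s + 4)" using ex_A_shift[of n] by auto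
  then have "A n \<le> A (Suc n)"
    using A_eq_ca[of n s] A_eq_ca[of "Suc n" s] step ca_mono[of "n + s" "Suc (n + s)"] by simp
  then show ?case using step by simp
qed simp

lemma B_mono: "m \<le> n \<Longrightarrow> 1 \<le> m \<Longrightarrow> B m \<le> B n"
proof (induction n rule: dec_induct)
  case (step n)
  then obtain s where s: "J (2 * s + 1) \<le> n + s" "n + s < J (2 * s + 3)" using ex_B_shift[of n] by auto
  then have "B n \<le> B (Suc n)"
    using B_eq_cb[of n s] B_eq_cb[of "Suc n" s] step cb_mono[of "n + s" "Suc (n + s)"] by simp
  then show ?case using step by simp
qed simp

lemma A_pos: "1 \<le> m \<Longrightarrow> 1 \<le> A m"
  using ex_A_shift[of m] A_eq_ca[of m] ca_pos[of "m + _"] by fastforce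

lemma B_pos: "1 \<le> m \<Longrightarrow> 1 \<le> B m"
  using ex_B_shift[of m] B_eq_cb[of m] by fastforce

lemma A_le_set:
  assumes "J (2 * s + 1) \<le> i" "i < J (2 * s + 3)"
  shows "{m. 1 \<le> m \<and> A m \<le> int i} = {1..LA i - s}"
proof -
  let ?m = "LA i - s"
  have b: "J (2 * s + 2) \<le> LA i" "LA i < J (2 * s + 4)" using LA_bounds assms by blast+
  have s: "s < LA i" using b J_ge(2)[of s] by simp
  have 1: "A ?m = int i" using A_eq_ca[of ?m s] b s LA_props(1)[of i] by simp
  have 2: "A (Suc ?m) = int i + 1"
    using A_eq_ca[of "Suc ?m" s] b s LA_props[of i] by (simp add: ca_Suc)
  show ?thesis
  proof (intro equalityI subsetI)
    fix m assume "m \<in> {m. 1 \<le> m \<and> A m \<le> int i}"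
    then show "m \<in> {1..?m}" using A_mono[of "Suc ?m" m] 2 by force
  next
    fix m assume "m \<in> {1..?m}"
    then show "m \<in> {m. 1 \<le> m \<and> A m \<le> int i}" using A_mono[of m ?m] 1 by simp
  qed
qed

lemma B_le_set:
  assumes "J (2 * s) < i" "i \<le> J (2 * s + 2)"
  shows "{m. 1 \<le> m \<and> B m \<le> int i} = {1..LB i - s}"
proof -
  let ?m = "LB i - s"
  have b: "J (2 * s + 1) \<le> LB i" "LB i < J (2 * s + 3)" using LB_bounds assms by blast+
  have s: "s < LB i" using b J_ge(1)[of s] by simp
  have i: "1 \<le> i" using assms by simp
  have 1: "B ?m = int i" using B_eq_cb[of ?m s] b s LB_props(1)[OF i] by simp
  have 2: "B (Suc ?m) = int i + 1"
    using B_eq_cb[of "Suc ?m" s] b s LB_props[OF i] by (simp add: cb_Suc)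
  show ?thesis
  proof (intro equalityI subsetI)
    fix m assume "m \<in> {m. 1 \<le> m \<and> B m \<le> int i}"
    then show "m \<in> {1..?m}" using B_mono[of "Suc ?m" m] 2 by force
  next
    fix m assume "m \<in> {1..?m}"
    then show "m \<in> {m. 1 \<le> m \<and> B m \<le> int i}" using B_mono[of m ?m] 1 by simp
  qed
qed

section \<open>Cumulative frequencies and the frequency recursion\<close>

definition cumA :: "nat \<Rightarrow> nat" where "cumA i = card {m. 1 \<le> m \<and> A m \<le> int i}"
definition cumB :: "nat \<Rightarrow> nat" where "cumB i = card {m. 1 \<le> m \<and> B m \<le> int i}"

lemma ex_between_odd: "1 \<le> i \<Longrightarrow> \<exists>s. J (2 * s + 1) \<le> i \<and> i < J (2 * s + 3)"
proof (induction i rule: dec_induct)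
  case base
  show ?case using J_3_4[of 0] by (intro exI[of _ 0]) (simp add: J_2)
next
  case (step i)
  then obtain s where s: "J (2 * s + 1) \<le> i" "i < J (2 * s + 3)" by blast
  have "J (2 * Suc s + 1) = J (2 * s + 3)" "J (2 * Suc s + 2) = J (2 * s + 4)"
    by (simp_all add: numeral_eq_Suc)
  then show ?case using s J_3_4(1)[of "Suc s"] J_3_4(2)[of s] J_pos[of "2 * s + 3"]
    by (cases "Suc i < J (2 * s + 3)"; intro exI[of _ "if Suc i < J (2 * s + 3) then s else Suc s"]) auto
qed

lemma ex_between_even: "1 \<le> i \<Longrightarrow> \<exists>s. J (2 * s) < i \<and> i \<le> J (2 * s + 2)"
proof (induction i rule: dec_induct)
  case base
  show ?case by (intro exI[of _ 0]) (simp add: J_2)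
next
  case (step i)
  then obtain s where s: "J (2 * s) < i" "i \<le> J (2 * s + 2)" by blast
  have "J (2 * Suc s) = J (2 * s + 2)" "J (2 * Suc s + 2) = J (2 * s + 4)"
    by (simp_all add: numeral_eq_Suc)
  then show ?case using s J_3_4[of s] J_pos[of "2 * s + 2"]
    by (cases "Suc i \<le> J (2 * s + 2)"; intro exI[of _ "if Suc i \<le> J (2 * s + 2) then s else Suc s"]) auto
qed

lemma cumA_eq: "J (2 * s + 1) \<le> i \<Longrightarrow> i < J (2 * s + 3) \<Longrightarrow> cumA i + s = LA i"
  using LA_bounds[of s i] J_ge(2)[of s] by (simp add: cumA_def A_le_set del: One_nat_def)

lemma cumB_eq: "J (2 * s) < i \<Longrightarrow> i \<le> J (2 * s + 2) \<Longrightarrow> cumB i + s = LB i"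
  using LB_bounds[of s i] J_ge(1)[of s] by (simp add: cumB_def B_le_set del: One_nat_def)

lemma cumA_0: "cumA 0 = 0" and cumB_0: "cumB 0 = 0"
proof -
  have "{m. 1 \<le> m \<and> A m \<le> int 0} = {}" "{m. 1 \<le> m \<and> B m \<le> int 0} = {}"
    using A_pos B_pos by force+
  then show "cumA 0 = 0" "cumB 0 = 0" unfolding cumA_def cumB_def by (simp_all only: card.empty)
qed

text \<open>In \<open>LA_rec\<close> the values \<open>i\<close> and \<open>ca i\<close> belong to
  the same shift, which cancels.\<close>

lemma cumA_rec: "cumA i = i + cumB (ca i)"
proof (cases "1 \<le> i")
  case True
  then obtain s where s: "J (2 * s + 1) \<le> i" "i < J (2 * s + 3)" using ex_between_odd by blast
  have "J (2 * s) < ca i" using ca_mono[OF s(1)] counts_J_odd(2)[of s] by simp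
  moreover have "ca i \<le> J (2 * s + 2)"
    using ca_mono[of i "J (2 * s + 3) - 1"] s(2) run_odd(1)[of s] J_3_4(1)[of s]
      ca_add_cb[of "J (2 * s + 3) - 1"] by linarith
  ultimately show ?thesis using cumA_eq[OF s] cumB_eq[of s "ca i"] LA_rec[of i] by simp
qed (simp add: cumA_0 cumB_0 not_le)

text \<open>In \<open>LB_rec\<close> the value \<open>cb i\<close> belongs to the shift one below
  that of \<open>i\<close> once \<open>2 \<le> i\<close>, which leaves a unit.\<close>

lemma cumB_rec: "cumB i + (if 2 \<le> i then 1 else 0) = i + cumA (cb i)"
proof (cases "2 \<le> i")
  case True
  then obtain s where s: "J (2 * s) < i" "i \<le> J (2 * s + 2)" using ex_between_even[of i] by auto
  obtain t where t: "s = Suc t" using s True by (cases s) (auto simp: J_2)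
  have st: "J (2 * t + 2) < i" "i \<le> J (2 * t + 4)" using s t by (simp_all add: numeral_eq_Suc)
  \<comment> \<open>At \<open>J (2 * t + 2)\<close> the count is one too small; the next letter is a
    b and supplies the missing one.\<close>
  have "J (2 * t + 1) \<le> cb (J (2 * t + 2) + 1)"
  proof (cases t)
    case 0
    then show ?thesis using wd_numerals(12) by (simp add: J_2 numeral_2_eq_2)
  next
    case (Suc u)
    have "\<not> wd (J (2 * t + 2) + 1)" using run_even(5)[of u] Suc by (simp add: numeral_eq_Suc)
    then show ?thesis using counts_J_even(2)[of t] by (simp add: cb_Suc)
  qed
  also have "\<dots> \<le> cb i" using st by (intro cb_mono) simp
  finally have 1: "J (2 * t + 1) \<le> cb i" .
  have "cb i \<le> cb (J (2 * t + 4))" using st by (intro cb_mono)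
  then have 2: "cb i < J (2 * t + 3)" using counts_J_even(2)[of "Suc t"] by (simp add: numeral_eq_Suc)
  show ?thesis using cumB_eq[OF s] cumA_eq[OF 1 2] LB_rec[of i] True t by simp
next
  case False
  then consider "i = 0" | "i = 1" by linarith
  then show ?thesis
  proof cases
    case 2
    then show ?thesis using cumB_eq[of 0 1] LB_rec[of 1] wd_numerals(11) by (simp add: J_2 cumA_0)
  qed (simp add: cumA_0 cumB_0)
qed

lemma F_A_cum: "1 \<le> v \<Longrightarrow> F_A v + cumA (v - 1) = cumA v"
proof -
  assume v: "1 \<le> v"
  let ?S = "\<lambda>i. {m. 1 \<le> m \<and> A m \<le> int i}"
  obtain s where s: "J (2 * s + 1) \<le> v" "v < J (2 * s + 3)" using ex_between_odd v by blast
  have fin: "finite (?S v)" using A_le_set[OF s] by simp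
  have sub: "?S (v - 1) \<subseteq> ?S v" using v by auto
  have "{m. 1 \<le> m \<and> A m = int v} = ?S v - ?S (v - 1)" using v by auto
  then show ?thesis using card_Diff_subset[OF finite_subset[OF sub fin] sub] card_mono[OF fin sub]
    by (simp add: F_A_def cumA_def)
qed

lemma F_B_cum: "1 \<le> v \<Longrightarrow> F_B v + cumB (v - 1) = cumB v"
proof -
  assume v: "1 \<le> v"
  let ?S = "\<lambda>i. {m. 1 \<le> m \<and> B m \<le> int i}"
  obtain s where s: "J (2 * s) < v" "v \<le> J (2 * s + 2)" using ex_between_even v by blast
  have fin: "finite (?S v)" using B_le_set[OF s] by simp
  have sub: "?S (v - 1) \<subseteq> ?S v" using v by auto
  have "{m. 1 \<le> m \<and> B m = int v} = ?S v - ?S (v - 1)" using v by auto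
  then show ?thesis using card_Diff_subset[OF finite_subset[OF sub fin] sub] card_mono[OF fin sub]
    by (simp add: F_B_def cumB_def)
qed

lemma F_A_rec: "1 \<le> v \<Longrightarrow> F_A v = (if wd v then 1 + F_B (ca v) else 1)"
proof -
  assume v: "1 \<le> v"
  have c: "ca v = ca (v - 1) + (if wd v then 1 else 0)" using ca_Suc[of "v - 1"] v by simp
  note F = F_A_cum[OF v] cumA_rec[of v] cumA_rec[of "v - 1"]
  show ?thesis
  proof (cases "wd v")
    case True
    then have "ca v - 1 = ca (v - 1)" "1 \<le> ca v" using c by auto
    then have "F_B (ca v) + cumB (ca (v - 1)) = cumB (ca v)" using F_B_cum[of "ca v"] by simp
    then have "F_A v = 1 + F_B (ca v)" using F v by linarith
    then show ?thesis using True by simp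
  next
    case False
    then have "ca v = ca (v - 1)" using c by simp
    then have "cumB (ca v) = cumB (ca (v - 1))" by simp
    then have "F_A v = 1" using F v by linarith
    then show ?thesis using False by simp
  qed
qed

text \<open>Difference of \<open>cumB_rec\<close> at \<open>v\<close> and \<open>v - 1\<close>. The
  correction switches on exactly at 2, so it lowers \<open>F_B 2\<close> from 3 to 2 and cancels for
  larger \<open>v\<close>.\<close>

lemma F_B_rec: "1 \<le> v \<Longrightarrow> F_B v = (if wd v then 1 else if v = 2 then 2 else 1 + F_A (cb v))"
proof -
  assume v: "1 \<le> v"
  have c: "cb v = cb (v - 1) + (if wd v then 0 else 1)" using cb_Suc[of "v - 1"] v by simp
  note F = F_B_cum[OF v] cumB_rec[of v] cumB_rec[of "v - 1"] F_A_cum[of "cb v"]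
  consider "v = 1" | "v = 2" | "3 \<le> v" using v by linarith
  then show ?thesis
  proof cases
    case 1
    then show ?thesis using F wd_1 wd_numerals by (simp add: cumA_0 cumB_0)
  next
    case 2
    have "F_A 1 = 2 \<Longrightarrow> F_B 2 = 2" using F c 2 wd_numerals by (simp add: cumA_0 cumB_0)
    moreover have "F_A 1 = 2"
      using F_A_rec[of 1] wd_1 wd_numerals F_B_cum[of 1] cumB_rec[of 1] by (simp add: cumB_0 cumA_0)
    ultimately show ?thesis using 2 wd_numerals(1) by simp
  next
    case 3
    then have F': "F_B v + cumB (v - 1) = cumB v" "cumB v + 1 = v + cumA (cb v)"
      "cumB (v - 1) + 1 = v - 1 + cumA (cb (v - 1))" using F(1-3) by (simp_all split: if_splits)
    show ?thesis
    proof (cases "wd v")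
      case True
      then have "cb v = cb (v - 1)" using c by simp
      then have "cumA (cb v) = cumA (cb (v - 1))" by simp
      then have "F_B v = 1" using F' v by linarith
      then show ?thesis using True by simp
    next
      case False
      then have "cb v - 1 = cb (v - 1)" "1 \<le> cb v" using c by auto
      then have "F_A (cb v) + cumA (cb (v - 1)) = cumA (cb v)" using F_A_cum[of "cb v"] by simp
      then have "F_B v = 1 + F_A (cb v)" using F' v by linarith
      then show ?thesis using False 3 by simp
    qed
  qed
qed

lemma F_A_pos: "1 \<le> v \<Longrightarrow> 1 \<le> F_A v" and F_B_pos: "1 \<le> v \<Longrightarrow> 1 \<le> F_B v"
  by (simp_all add: F_A_rec F_B_rec)

lemma F_A_1: "F_A 1 = 2" and F_B_1: "F_B 1 = 1"
  using F_A_rec[of 1] F_B_rec[of 1] wd_1 wd_numerals(6) by simp_all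

section \<open>Antisymmetry about powers of two\<close>

lemma counts_J: "J n \<le> ca (J (Suc n))" "ca (J (Suc n)) \<le> J n + 1"
  "J n \<le> cb (J (Suc n)) + 1" "cb (J (Suc n)) \<le> J n"
proof -
  have "J n \<le> ca (J (Suc n)) \<and> ca (J (Suc n)) \<le> J n + 1 \<and> J n \<le> cb (J (Suc n)) + 1 \<and> cb (J (Suc n)) \<le> J n"
  proof (cases "even n")
    case True
    then obtain s where "n = 2 * s" by blast
    then show ?thesis using counts_J_odd[of s] by simp
  next
    case False
    then obtain s where s: "n = 2 * s + 1" by (auto elim: oddE)
    then show ?thesis using counts_J_even[of s] by simp
  qed
  then show "J n \<le> ca (J (Suc n))" "ca (J (Suc n)) \<le> J n + 1"
    "J n \<le> cb (J (Suc n)) + 1" "cb (J (Suc n)) \<le> J n" by blast+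
qed

text \<open>By \<open>J_add_Suc\<close> the window is \<open>J j\<close> to
  \<open>J (Suc j) + 1\<close>; for positive \<open>j\<close> its centre lies just after
  \<open>2 ^ (j - 1)\<close>.\<close>

definition antisym_at :: "nat \<Rightarrow> bool" where
  "antisym_at j \<longleftrightarrow> (\<forall>x y. x + y = 2 ^ j + 1 \<and> J j \<le> x \<and> J j \<le> y \<longrightarrow> wd y = (\<not> wd x))"

lemma antisym_atD: "antisym_at j \<Longrightarrow> x + y = 2 ^ j + 1 \<Longrightarrow> J j \<le> x \<Longrightarrow> J j \<le> y \<Longrightarrow> wd y = (\<not> wd x)"
  by (auto simp: antisym_at_def)

text \<open>With \<open>c = 2 ^ j\<close>, positions \<open>ca c\<close> and
  \<open>Suc (cb c)\<close> add up to \<open>c + 1\<close>, so they are mirror images. Equal letters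
  at \<open>c\<close> and \<open>Suc c\<close> would force equal letters at these two.\<close>

lemma antisym_centre:
  assumes j: "3 \<le> j" and R: "antisym_at j"
  shows "wd (Suc (2 ^ j)) = (\<not> wd (2 ^ j))"
proof -
  let ?c = "2 ^ j :: nat"
  have c2: "2 \<le> ?c" using j power_increasing[of 1 j "2::nat"] by simp
  have cJ: "?c = J j + J (Suc j)" by (simp add: J_add_Suc)
  have "J (Suc j) \<le> ?c" using cJ by simp
  then have "J j \<le> ca ?c" "J j \<le> Suc (cb ?c)"
    using counts_J[of j] ca_mono[of "J (Suc j)" ?c] cb_mono[of "J (Suc j)" ?c] by linarith+
  then have sym: "wd (Suc (cb ?c)) = (\<not> wd (ca ?c))"
    using antisym_atD[OF R, of "ca ?c" "Suc (cb ?c)"] ca_add_cb[of ?c] by simp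
  show ?thesis
    using sym wd_Suc_a[of ?c] wd_Suc_b[of ?c] wd_cb_before_a[of ?c] wd_ca_before_b[of ?c] c2
    by (cases "wd ?c"; cases "wd (Suc ?c)") simp_all
qed

text \<open>
  Walking outwards from the centre, the successor rule on the right and the predecessor rule on the left
  consult letters whose positions add up to \<open>2 ^ j + 1\<close>.
\<close>

lemma antisym_step:
  assumes j: "3 \<le> j" and R: "antisym_at j"
  shows "antisym_at (Suc j)"
proof -
  define c :: nat where "c = 2 ^ j"
  have cJ: "c = J j + J (Suc j)" by (simp add: J_add_Suc c_def)
  have JSS: "J (Suc (Suc j)) = c + J j" using cJ by (simp add: J.simps(3))
  have J3: "3 \<le> J (Suc j)" using J_mono[of 3 "Suc j"] j by (simp add: J.simps(3) numeral_3_eq_3)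
  have bnd: "J j \<le> ca X" "ca X \<le> J (Suc j) + 1" "J j \<le> Suc (cb X)" "cb X \<le> J (Suc j)"
    if "c \<le> X" "X \<le> c + J j" for X
  proof -
    have "J (Suc j) \<le> X" "X \<le> J (Suc (Suc j))" using that cJ JSS by linarith+
    then show "J j \<le> ca X" "ca X \<le> J (Suc j) + 1" "J j \<le> Suc (cb X)" "cb X \<le> J (Suc j)"
      using counts_J[of j] counts_J[of "Suc j"] ca_mono[of "J (Suc j)" X] cb_mono[of "J (Suc j)" X]
        ca_mono[of X "J (Suc (Suc j))"] cb_mono[of X "J (Suc (Suc j))"] by linarith+
  qed
  have sym: "wd y = (\<not> wd x)" if "x + y = c + 1" "J j \<le> x" "x \<le> J (Suc j) + 1" for x y
    using antisym_atD[OF R, of x y] that cJ by (simp add: c_def)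
  \<comment> \<open>The count identity is carried along since it makes the letters consulted at both
    ends mirror images in the smaller window: \<open>ca X + Suc (cb v) = c + 1\<close>.\<close>
  have main: "wd (c + e) = (\<not> wd (Suc c - e)) \<and> ca (c + e) + cb (c - e) = c"
    if "1 \<le> e" "e \<le> J j + 1" for e
    using that
  proof (induction e rule: dec_induct)
    case base
    have "wd (Suc c) = (\<not> wd c)" using antisym_centre[OF j R] by (simp add: c_def)
    moreover have "c = Suc (c - 1)" using J3 cJ by simp
    then have "cb c = cb (c - 1) + (if wd c then 0 else 1)" by (metis cb_Suc)
    ultimately show ?case using ca_add_cb[of c] by (simp add: ca_Suc split: if_splits)
  next
    case (step e)
    define X where "X = c + e"
    define v where "v = c - e"
    have e: "e \<le> J j" using step by simp
    have v3: "3 \<le> v" using e cJ J3 by (simp add: v_def)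
    have Sv: "Suc c - e = Suc v" using e cJ by (simp add: v_def)
    have IH: "wd X = (\<not> wd (Suc v))" "ca X + cb v = c"
      using step Sv by (simp_all add: X_def v_def)
    have Xv: "X + v = 2 * c" using e cJ by (simp add: X_def v_def)
    have IH2: "cb X + ca v = c" using IH(2) ca_add_cb[of X] ca_add_cb[of v] Xv by linarith
    have X: "c \<le> X" "X \<le> c + J j" "1 \<le> X" using e J3 cJ by (auto simp: X_def)
    note b = bnd[OF X(1,2)]
    have opp: "wd (Suc X) = (\<not> wd v)"
    proof (cases "wd X")
      case True
      then have "wd v = (\<not> wd (Suc (cb v)))" using wd_pred_b[OF v3] IH by simp
      moreover have "wd (Suc (cb v)) = (\<not> wd (ca X))" using IH b by (intro sym) auto
      ultimately show ?thesis using wd_Suc_a[OF X(3) True] by simp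
    next
      case False
      then have "wd v = (\<not> wd (ca v))" using wd_pred_a[of v] v3 IH by simp
      moreover have "wd (ca v) = (\<not> wd (Suc (cb X)))" using IH2 b by (intro sym) auto
      ultimately show ?thesis using wd_Suc_b[OF X(3) False] by simp
    qed
    have "v = Suc (v - 1)" using v3 by simp
    then have "cb v = cb (v - 1) + (if wd v then 0 else 1)" by (metis cb_Suc)
    then have "ca (Suc X) + cb (v - 1) = c" using opp IH(2) by (simp add: ca_Suc split: if_splits)
    moreover have "c + Suc e = Suc X" "Suc c - Suc e = v" "c - Suc e = v - 1"
      by (simp_all add: X_def v_def)
    ultimately show ?case using opp by simp
  qed
  show ?thesis unfolding antisym_at_def
  proof (intro allI impI)
    fix x y :: nat
    assume xy: "x + y = 2 ^ Suc j + 1 \<and> J (Suc j) \<le> x \<and> J (Suc j) \<le> y"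
    then have s: "x + y = 2 * c + 1" by (simp add: c_def)
    show "wd y = (\<not> wd x)"
    proof (cases "x \<le> c")
      case True
      have "c + (Suc c - x) = y" "Suc c - (Suc c - x) = x" using s True by auto
      moreover have "1 \<le> Suc c - x" "Suc c - x \<le> J j + 1" using True xy cJ by linarith+
      ultimately show ?thesis using main[of "Suc c - x"] by simp
    next
      case False
      have "c + (x - c) = x" "Suc c - (x - c) = y" using s False by auto
      moreover have "1 \<le> x - c" "x - c \<le> J j + 1" using False xy cJ s by linarith+
      ultimately show ?thesis using main[of "x - c"] by auto
    qed
  qed
qed

text \<open>The induction starts at 3: for \<open>j = 2\<close> the mirror positions 1 and 4 both
  carry a.\<close>

lemma antisym: "3 \<le> j \<Longrightarrow> antisym_at j"
proof (induction j rule: dec_induct)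
  case base
  have J: "J 3 = 3" by (simp add: numeral_3_eq_3 J.simps(3))
  show ?case unfolding antisym_at_def
  proof (intro allI impI)
    fix x y :: nat
    assume xy: "x + y = 2 ^ 3 + 1 \<and> J 3 \<le> x \<and> J 3 \<le> y"
    then consider "x = 3" "y = 6" | "x = 4" "y = 5" | "x = 5" "y = 4" | "x = 6" "y = 3"
      using J by fastforce
    then show "wd y = (\<not> wd x)" by cases (use wd_numerals in simp_all)
  qed
next
  case (step j)
  then show ?case using antisym_step by blast
qed

text \<open>Start from \<open>ca h + cb h = h\<close> with \<open>h = 2 ^ j\<close> and move the
  arguments apart: by antisymmetry \<open>ca\<close> gains an a exactly when \<open>cb\<close> loses
  a b.\<close>

lemma half_sum:
  assumes "x + y = 2 ^ Suc j" "J (Suc j) \<le> x" "J (Suc j) \<le> y"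
  shows "ca x + cb y = 2 ^ j"
proof -
  consider "j = 0" | "j = 1" | "2 \<le> j" by linarith
  then show ?thesis
  proof cases
    case 1
    then have "x = 1" "y = 1" using assms by auto
    then show ?thesis using 1 wd_numerals by simp
  next
    case 2
    then have "x = 1 \<and> y = 3 \<or> x = 2 \<and> y = 2 \<or> x = 3 \<and> y = 1" using assms J_2 by auto
    then show ?thesis using 2 wd_numerals by auto
  next
    case 3
    define h :: nat where "h = 2 ^ j"
    have hJ: "h = J j + J (Suc j)" by (simp add: h_def J_add_Suc)
    have walk: "ca (h + d) + cb (h - d) = h" if "d \<le> J j" for d
      using that
    proof (induction d)
      case 0
      then show ?case by (simp add: ca_add_cb)
    next
      case (Suc d)
      have "wd (h - d) = (\<not> wd (Suc (h + d)))"
        using antisym_atD[OF antisym[of "Suc j"], of "Suc (h + d)" "h - d"] 3 Suc.prems hJ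
        by (simp add: h_def)
      moreover have "h - d = Suc (h - Suc d)" using Suc.prems hJ J_pos[of "Suc j"] by simp
      ultimately show ?case using Suc by (simp add: ca_Suc cb_Suc split: if_splits)
    qed
    show ?thesis
    proof (cases "h \<le> x")
      case True
      have "h + (x - h) = x" "h - (x - h) = y" "x - h \<le> J j"
        using True assms hJ by (auto simp: h_def)
      then show ?thesis using walk[of "x - h"] by (simp add: h_def)
    next
      case False
      have "h + (y - h) = y" "h - (y - h) = x" "y - h \<le> J j"
        using False assms hJ by (auto simp: h_def)
      then have "ca y + cb x = h" using walk[of "y - h"] by simp
      then show ?thesis using ca_add_cb[of x] ca_add_cb[of y] assms(1) by (simp add: h_def)
    qed
  qed
qed

section \<open>Letters and frequencies at powers of four\<close>

lemma counts_pow4: "J (2 * k) \<le> cb (4 ^ k)" "J (2 * k) + 1 \<le> ca (4 ^ k)"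
proof -
  have "J (2 * k + 1) \<le> 4 ^ k" using J_add_Suc[of "2 * k"] by (simp add: power_mult)
  then show "J (2 * k) \<le> cb (4 ^ k)" "J (2 * k) + 1 \<le> ca (4 ^ k)"
    using counts_J_odd[of k] ca_mono[of "J (2 * k + 1)" "4 ^ k"] cb_mono[of "J (2 * k + 1)" "4 ^ k"]
    by simp_all
qed

text \<open>Parity: \<open>half_sum\<close> for \<open>ca c\<close> and \<open>cb c\<close> gives an
  even sum, but an a after \<open>c = 4 ^ k\<close> would make \<open>ca (ca c)\<close> exceed
  \<open>cb (cb c)\<close> by one. So a b follows \<open>c\<close>, and for \<open>k > 1\<close>
  antisymmetry at the centre gives letter \<open>c\<close>.\<close>

lemma wd_pow4:
  assumes k: "1 \<le> k"
  shows "wd (4 ^ k)" "wd (ca (4 ^ k))"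
proof -
  define c :: nat where "c = 4 ^ k"
  have c: "c = 2 ^ (2 * k)" by (simp add: c_def power_mult)
  have c4: "4 \<le> c" using power_increasing[of 1 k "4::nat"] k by (simp add: c_def)
  obtain i where i: "2 * k = Suc (Suc i)" using k by (cases k) auto
  have hs: "ca (ca c) + cb (cb c) = 2 * 2 ^ i"
    using half_sum[of "ca c" "cb c" "Suc i"] counts_pow4[of k] ca_add_cb[of c] i
    by (simp add: c_def[symmetric] c)
  have nb: "\<not> wd (Suc c)"
  proof
    assume w: "wd (Suc c)"
    then have "\<not> wd (Suc (cb c))" using wd_cb_before_a c4 by simp
    then have "ca (ca c) = Suc (cb (cb c))" using ab_eq_ba[of c] c4 w by (simp add: cb_Suc)
    then have "Suc (2 * cb (cb c)) = 2 * 2 ^ i" using hs by simp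
    then show False by presburger
  qed
  show "wd (ca (4 ^ k))" using wd_ca_before_b[of c] nb c4 by (simp add: c_def)
  show "wd (4 ^ k)"
  proof (cases "k = 1")
    case True
    then show ?thesis using wd_numerals by simp
  next
    case False
    then have "3 \<le> 2 * k" using k by simp
    then show ?thesis using antisym_centre[OF _ antisym, of "2 * k"] nb by (simp add: c power_mult)
  qed
qed

lemma F_pow4:
  assumes "1 \<le> k"
  shows "F_A (4 ^ k) = 2" "F_B (4 ^ k) = 1"
  using F_A_rec[of "4 ^ k"] F_B_rec[of "4 ^ k"] F_B_rec[of "ca (4 ^ k)"] wd_pow4[OF assms]
    counts_pow4[of k] by simp_all

section \<open>Counting frequencies\<close>

definition cnt_ge :: "(nat \<Rightarrow> nat) \<Rightarrow> nat \<Rightarrow> nat \<Rightarrow> nat" where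
  "cnt_ge f r x = card {v \<in> {1..x}. r \<le> f v}"

lemma card_filter_Suc:
  "card {v \<in> {1..Suc x}. P v} = card {v \<in> {1..x}. P v} + (if P (Suc x) then 1 else 0)"
proof -
  have "{v \<in> {1..Suc x}. P v} = (if P (Suc x) then insert (Suc x) {v \<in> {1..x}. P v} else {v \<in> {1..x}. P v})"
    by (auto simp: le_Suc_eq)
  then show ?thesis by simp
qed

lemma cnt_ge_0: "cnt_ge f r 0 = 0"
  by (simp add: cnt_ge_def)

lemma cnt_ge_Suc: "cnt_ge f r (Suc x) = cnt_ge f r x + (if r \<le> f (Suc x) then 1 else 0)"
  unfolding cnt_ge_def by (rule card_filter_Suc)

lemma cnt_ge_1: "(\<And>v. 1 \<le> v \<Longrightarrow> 1 \<le> f v) \<Longrightarrow> cnt_ge f 1 x = x"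
  by (induction x) (simp_all add: cnt_ge_0 cnt_ge_Suc)

text \<open>Frequencies above 1 occur for \<open>F_A\<close> only at letters a, which
  \<open>ca\<close> numbers from 1 to \<open>ca x\<close>.\<close>

lemma cnt_A_rec: "1 \<le> r \<Longrightarrow> cnt_ge F_A (Suc r) x = cnt_ge F_B r (ca x)"
  by (induction x) (auto simp: cnt_ge_0 cnt_ge_Suc ca_Suc F_A_rec)

text \<open>The correction term comes from \<open>F_B 2 = 2\<close> while \<open>F_A (cb 2) = F_A 1 = 2\<close>.\<close>

lemma cnt_B_rec:
  assumes "1 \<le> r"
  shows "cnt_ge F_B (Suc r) y + (if r = 2 \<and> 2 \<le> y then 1 else 0) = cnt_ge F_A r (cb y)"
proof (induction y)
  case (Suc y)
  show ?case
  proof (cases "y = 1")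
    case True
    have "F_B 2 = 2" using F_B_rec[of 2] wd_numerals(1) by simp
    moreover have "cb 2 = Suc 0" "cb 1 = 0" using wd_numerals by simp_all
    ultimately show ?thesis using True assms Suc F_A_1 F_B_1
      by (auto simp: cnt_ge_0 cnt_ge_Suc numeral_2_eq_2)
  next
    case False
    have *: "F_B (Suc y) = (if wd (Suc y) then 1 else 1 + F_A (Suc (cb y)))"
      using F_B_rec[of "Suc y"] False by (auto simp: cb_Suc)
    show ?thesis
      using Suc assms False by (auto simp: cnt_ge_Suc cb_Suc * split: if_splits)
  qed
qed (simp add: cnt_ge_0)

lemma cnt_pair_rec:
  assumes "1 \<le> r"
  shows "cnt_ge F_A (Suc r) x + cnt_ge F_B (Suc r) y + (if r = 2 \<and> 2 \<le> y then 1 else 0) =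
    cnt_ge F_A r (cb y) + cnt_ge F_B r (ca x)"
  using cnt_A_rec[OF assms, of x] cnt_B_rec[OF assms, of y] by simp

text \<open>Each use of \<open>cnt_pair_rec\<close> swaps the roles, lowers \<open>r\<close> and, by
  \<open>half_sum\<close>, halves \<open>x + y\<close>. The exception \<open>F_B 2\<close> is met at
  most once on the way down, hence the unit term. The extra 1 in the bound makes up for the count of
  b at \<open>J j\<close>, which is one short for positive even \<open>j\<close>.\<close>

lemma cnt_pair:
  assumes "J j \<le> x" "J j + (if even j then 1 else 0) \<le> y" "x + y = 2 ^ j" "1 \<le> r"
  shows "cnt_ge F_A r x + cnt_ge F_B r y + (if 3 \<le> r \<and> r \<le> j + 1 then 1 else 0) =
    (if r \<le> j + 1 then 2 ^ (j + 1 - r) else 0)"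
  using assms
proof (induction j arbitrary: x y r)
  case 0
  then have "x = 0" "y = Suc 0" by auto
  then show ?case using F_B_1 0 by (simp add: cnt_ge_0 cnt_ge_Suc)
next
  case (Suc j)
  show ?case
  proof (cases "r = 1")
    case True
    then show ?thesis using Suc.prems(3) by (simp only: cnt_ge_1 F_A_pos F_B_pos) simp
  next
    case False
    then obtain r' where r: "r = Suc r'" "1 \<le> r'" using Suc.prems(4) by (cases r) auto
    have Jy: "J (Suc j) \<le> y" using Suc.prems(2) by simp
    have sum: "cb y + ca x = 2 ^ j" using half_sum[OF Suc.prems(3,1) Jy] by simp
    have lower: "J j \<le> cb y \<and> J j + (if even j then 1 else 0) \<le> ca x"
    proof (cases "even j")
      case True
      then obtain s where "j = 2 * s" by blast
      then show ?thesis using counts_J_odd[of s] ca_mono[OF Suc.prems(1)] cb_mono[OF Jy] by simp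
    next
      case False
      then obtain s where s: "j = 2 * s + 1" by (auto elim: oddE)
      have Jy': "J (Suc j) + 1 \<le> y" using Suc.prems(2) False by simp
      have "J j \<le> cb (J (Suc j) + 1)"
      proof (cases s)
        case 0
        then show ?thesis using s wd_numerals(12) by (simp add: J_2 numeral_2_eq_2)
      next
        case (Suc u)
        have "\<not> wd (J (Suc j) + 1)" using run_even(5)[of u] Suc s by (simp add: numeral_eq_Suc)
        then show ?thesis using counts_J[of j] by (simp add: cb_Suc)
      qed
      then show ?thesis using False cb_mono[OF Jy'] ca_mono[OF Suc.prems(1)] counts_J(1)[of j] by simp
    qed
    have y2: "2 \<le> y \<longleftrightarrow> 1 \<le> j"
    proof (cases "j = 0")
      case True
      then show ?thesis using Suc.prems by simp
    next
      case False
      then consider "j = 1" | "3 \<le> Suc j" by linarith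
      then show ?thesis
      proof cases
        case 1
        then show ?thesis using Suc.prems(2) by (simp add: J_2)
      next
        case 2
        then have "J 3 \<le> y" using J_mono[OF 2] Jy by simp
        then show ?thesis using False by (simp add: numeral_3_eq_3 J.simps(3))
      qed
    qed
    have "cnt_ge F_A r' (cb y) + cnt_ge F_B r' (ca x) + (if 3 \<le> r' \<and> r' \<le> j + 1 then 1 else 0) =
      (if r' \<le> j + 1 then 2 ^ (j + 1 - r') else 0)"
      using Suc.IH lower sum r(2) by blast
    then show ?thesis using cnt_pair_rec[OF r(2), of x y] y2 r by (auto split: if_splits)
  qed
qed

lemma cnt_pow4:
  assumes "1 \<le> k" "1 \<le> r"
  shows "cnt_ge F_A r (4 ^ k) + cnt_ge F_B r (4 ^ k) + (if 3 \<le> r \<and> r \<le> 2 * k + 2 then 1 else 0) =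
    (if r \<le> 2 * k + 2 then 2 ^ (2 * k + 2 - r) else 0)"
proof (cases "r = 1")
  case True
  then show ?thesis by (simp only: cnt_ge_1 F_A_pos F_B_pos) (simp add: power_mult)
next
  case False
  then obtain r' where r: "r = Suc r'" "1 \<le> r'" using assms by (cases r) auto
  have "cb (4 ^ k) + ca (4 ^ k) = 2 ^ (2 * k)" using ca_add_cb[of "4 ^ k"] by (simp add: power_mult)
  then have "cnt_ge F_A r' (cb (4 ^ k)) + cnt_ge F_B r' (ca (4 ^ k)) +
      (if 3 \<le> r' \<and> r' \<le> 2 * k + 1 then 1 else 0) =
    (if r' \<le> 2 * k + 1 then 2 ^ (2 * k + 1 - r') else 0)"
    using cnt_pair[of "2 * k" "cb (4 ^ k)" "ca (4 ^ k)" r'] counts_pow4[of k] r(2) by simp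
  moreover have "2 \<le> (4::nat) ^ k" using power_increasing[of 1 k "4::nat"] assms by simp
  ultimately show ?thesis using cnt_pair_rec[OF r(2), of "4 ^ k" "4 ^ k"] r assms
    by (auto split: if_splits)
qed

section \<open>From initial segments to the intervals \<open>I k\<close>\<close>

lemma card_level_set:
  assumes "f (4 ^ k) = f (4 ^ (k + 1))"
  shows "card {v \<in> I k. f v = r} + cnt_ge f r (4 ^ k) + cnt_ge f (Suc r) (4 ^ (k + 1)) =
    cnt_ge f r (4 ^ (k + 1)) + cnt_ge f (Suc r) (4 ^ k)"
proof -
  define E where "E x = card {v \<in> {1..x}. f v = r}" for x :: nat
  have split: "cnt_ge f r x = E x + cnt_ge f (Suc r) x" for x
  proof (induction x)
    case (Suc x)
    have "E (Suc x) = E x + (if f (Suc x) = r then 1 else 0)"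
      unfolding E_def by (rule card_filter_Suc)
    then show ?case using Suc by (auto simp: cnt_ge_Suc)
  qed (simp add: cnt_ge_0 E_def)
  define p q :: nat where "p = 4 ^ k - 1" and "q = 4 ^ (k + 1) - 1"
  have "(1::nat) \<le> 4 ^ k" "(4::nat) ^ k \<le> 4 ^ (k + 1)" by simp_all
  then have pq: "Suc p = 4 ^ k" "Suc q = 4 ^ (k + 1)" "p \<le> q" by (simp_all add: p_def q_def)
  have "{v \<in> {1..q}. f v = r} = {v \<in> {1..p}. f v = r} \<union> {v \<in> I k. f v = r}"
    using pq by (auto simp: I_def q_def[symmetric] pq(1)[symmetric])
  moreover have "{v \<in> {1..p}. f v = r} \<inter> {v \<in> I k. f v = r} = {}"
    by (auto simp: I_def pq(1)[symmetric])
  moreover have "finite {v \<in> I k. f v = r}" by (simp add: I_def)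
  ultimately have "E q = E p + card {v \<in> I k. f v = r}"
    unfolding E_def by (simp add: card_Un_disjoint)
  moreover have "E (Suc p) = E p + (if f (Suc p) = r then 1 else 0)"
    "E (Suc q) = E q + (if f (Suc q) = r then 1 else 0)"
    unfolding E_def by (rule card_filter_Suc)+
  \<comment> \<open>\<open>I k\<close> contains \<open>4 ^ k\<close> and omits
    \<open>4 ^ (k + 1)\<close>, the difference of the initial segments does the opposite; equal
    values of \<open>f\<close> at both ends make up for it.\<close>
  ultimately have "E (4 ^ (k + 1)) = E (4 ^ k) + card {v \<in> I k. f v = r}"
    using assms pq by simp
  then show ?thesis using split by simp
qed

lemma S_0: "S k 0 = 0"
proof -
  have "F_A v \<noteq> 0 \<and> F_B v \<noteq> 0" if "v \<in> I k" for v
  proof -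
    have "(1::nat) \<le> 4 ^ k" by simp
    then have "1 \<le> v" using that unfolding I_def by (simp only: atLeastAtMost_iff) linarith
    then show ?thesis using F_A_pos[of v] F_B_pos[of v] by simp
  qed
  then have "{v \<in> I k. F_A v = 0} = {}" "{v \<in> I k. F_B v = 0} = {}" by auto
  then show ?thesis unfolding S_def by (simp only: card.empty)
qed

lemma S_cnt:
  assumes "1 \<le> k"
  defines "G \<equiv> \<lambda>r k. cnt_ge F_A r (4 ^ k) + cnt_ge F_B r (4 ^ k)"
  shows "S k r + G r k + G (Suc r) (k + 1) = G r (k + 1) + G (Suc r) k"
  using card_level_set[of F_A k r] card_level_set[of F_B k r] F_pow4[of k] F_pow4[of "k + 1"] assms
  by (simp add: S_def)

text \<open>A second difference of the powers in \<open>cnt_pow4\<close>. The unit terms cancel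
  while \<open>Suc r \<le> 2 * k + 2\<close>; beyond that they no longer do, which gives the
  exceptional values 2 and 1.\<close>

lemma S_values:
  assumes "1 \<le> k"
  shows "1 \<le> r \<Longrightarrow> r \<le> 2 * k + 1 \<Longrightarrow> S k r = 3 * 2 ^ (2 * k + 1 - r)"
    and "S k (2 * k + 2) = 2" and "S k (2 * k + 3) = 1" and "2 * k + 4 \<le> r \<Longrightarrow> S k r = 0"
proof -
  note cnt = cnt_pow4[OF assms] cnt_pow4[of "k + 1"] S_cnt[OF assms]
  show "S k r = 3 * 2 ^ (2 * k + 1 - r)" if r: "1 \<le> r" "r \<le> 2 * k + 1"
  proof -
    define n where "n = 2 * k + 1 - r"
    have "2 * k + 2 - r = n + 1" "2 * k + 2 - Suc r = n"
      "2 * (k + 1) + 2 - r = n + 3" "2 * (k + 1) + 2 - Suc r = n + 2" using r by (auto simp: n_def)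
    then show ?thesis
      using cnt(1)[of r] cnt(1)[of "Suc r"] cnt(2)[of r] cnt(2)[of "Suc r"] cnt(3)[of r] r
      by (simp add: power_add n_def[symmetric] split: if_splits)
  qed
  show "S k (2 * k + 2) = 2"
    using cnt(1)[of "2 * k + 2"] cnt(1)[of "2 * k + 3"] cnt(2)[of "2 * k + 2"] cnt(2)[of "2 * k + 3"]
      cnt(3)[of "2 * k + 2"] assms by (simp add: numeral_3_eq_3)
  show "S k (2 * k + 3) = 1"
    using cnt(1)[of "2 * k + 3"] cnt(1)[of "2 * k + 4"] cnt(2)[of "2 * k + 3"] cnt(2)[of "2 * k + 4"]
      cnt(3)[of "2 * k + 3"] assms by (simp add: add.commute)
  show "S k r = 0" if "2 * k + 4 \<le> r"
    using cnt(1)[of r] cnt(1)[of "Suc r"] cnt(2)[of r] cnt(2)[of "Suc r"] cnt(3)[of r] that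
    by (cases "r = 2 * k + 4") simp_all
qed

lemma sum_pow2_rev: "(\<Sum>r = 1..n. 3 * 2 ^ (n - r)) + 3 = 3 * (2::nat) ^ n"
proof (induction n)
  case (Suc n)
  have "(\<Sum>r = 1..n. 3 * (2::nat) ^ (Suc n - r)) = 2 * (\<Sum>r = 1..n. 3 * 2 ^ (n - r))"
    unfolding sum_distrib_left by (rule sum.cong) (auto simp: Suc_diff_le)
  then show ?case using Suc by simp
qed simp

theorem theorem7p1:
  fixes k :: nat
  assumes "1 \<le> k"
  shows "(\<forall>r. 1 \<le> r \<and> r \<le> 2 * k + 1 \<longrightarrow> S k r = 3 * 2 ^ (2 * k + 1 - r))
    \<and> S k (2 * k + 2) = 2
    \<and> S k (2 * k + 3) = 1
    \<and> (\<lambda>r. S k r) sums (6 * 4 ^ k)"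
proof -
  note v = S_values[OF assms]
  \<comment> \<open>Finite support turns the series into a finite sum.\<close>
  have "S k r = 0" if "r \<notin> {1..2 * k + 3}" for r
  proof (cases "r = 0")
    case False
    then show ?thesis using that by (intro v(4)) auto
  qed (simp add: S_0)
  then have "(\<lambda>r. S k r) sums (\<Sum>r = 1..2 * k + 3. S k r)" by (intro sums_finite) auto
  moreover have "(\<Sum>r = 1..2 * k + 3. S k r) = (\<Sum>r = 1..2 * k + 1. S k r) + 2 + 1"
    using v(2,3) by (simp add: numeral_eq_Suc)
  moreover have "(\<Sum>r = 1..2 * k + 1. S k r) = (\<Sum>r = 1..2 * k + 1. 3 * 2 ^ (2 * k + 1 - r))"
    using v(1) by (intro sum.cong) auto
  ultimately have "(\<lambda>r. S k r) sums (6 * 4 ^ k)"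
    using sum_pow2_rev[of "2 * k + 1"] by (simp add: power_mult)
  then show ?thesis using v(1-3) by blast
qed

end
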